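(* Let $n\ge1$ be an integer and $1\le p\le\infty$. Assume that $\psi\in H_n^\infty(\mathbb C^+)$ or $\psi\in H_n^p(\mathbb C^+)$, and that $\varphi$ is a holomorphic self-map of $\mathbb C^+$ such that $\varphi'\in H_{n-1}^\infty(\mathbb C^+)$ and $\varphi$ has a finite angular derivative at infinity. Then the weighted composition operator $T_{\psi,\varphi}F=\psi\cdot(F\circ\varphi)$ is bounded on $H_n^p(\mathbb C^+)$.
   Context: $\mathbb C^+=\{z\in\mathbb C:\operatorname{Im} z>0\}$. A holomorphic self-map $\varphi$ of $\mathbb C^+$ is said to have a finite angular derivative at infinity if $\sup_{z\in\mathbb C^+}\frac{\operatorname{Im}(z)}{\operatorname{Im}(\varphi(z))}<\infty$. For $1\le p<\infty$, $H^p(\mathbb C^+)$ is the space of holomorphic $F$ on $\mathbb C^+$ with $\|F\|_{H^p}=\sup_{y>0}\left(\int_{\mathbb R}|F(x+iy)|^p\,dx\right)^{1/p}<\infty$; $H^\infty(\mathbb C^+)$ is the space of bounded holomorphic functions with the sup norm. For an integer $m\ge0$, $H_m^p(\mathbb C^+)$ is the Banach space of holomorphic $F$ on $\mathbb C^+$ with $F^{(k)}\in H^p(\mathbb C^+)$ for $k=0,1,\dots,m$, with norm $\|F\|_{H_m^p}=\left(\sum_{k=0}^m\|F^{(k)}\|_{H^p}^p\right)^{1/p}$ if $1\le p<\infty$ and $\|F\|_{H_m^\infty}=\sum_{k=0}^m\|F^{(k)}\|_{H^\infty}$ if $p=\infty$. *)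

theory Defs
  imports "HOL-Complex_Analysis.Complex_Analysis"
begin

definition upper_half_plane :: "complex set" where
  "upper_half_plane = {z. 0 < Im z}"

definition holomorphic_self_map :: "(complex \<Rightarrow> complex) \<Rightarrow> bool" where
  "holomorphic_self_map \<phi> \<longleftrightarrow>
     \<phi> holomorphic_on upper_half_plane \<and> \<phi> ` upper_half_plane \<subseteq> upper_half_plane"

definition finite_angular_derivative_at_infinity :: "(complex \<Rightarrow> complex) \<Rightarrow> bool" where
  "finite_angular_derivative_at_infinity \<phi> \<longleftrightarrow>
     bdd_above ((\<lambda>z. Im z / Im (\<phi> z)) ` upper_half_plane)"

text \<open>
  Functions on the upper half-plane are total functions on the complex numbers whose
  values outside the half-plane are irrelevant. The exponent \<open>p\<close> ranges over
  \<open>[1, \<infinity>]\<close> inside \<^typ>\<open>ennreal\<close>. The norms below are real-valued and are meaningful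
  only on members of the corresponding space, where all integrals and suprema are finite.
\<close>

definition line_norm :: "real \<Rightarrow> (complex \<Rightarrow> complex) \<Rightarrow> real \<Rightarrow> real" where
  "line_norm p F y = (LINT x|lborel. norm (F (Complex x y)) powr p) powr (1 / p)"

definition hardy_space :: "ennreal \<Rightarrow> (complex \<Rightarrow> complex) set" where
  "hardy_space p = {F. F holomorphic_on upper_half_plane \<and>
     (if p = \<infinity> then bdd_above ((\<lambda>z. norm (F z)) ` upper_half_plane)
      else (\<forall>y>0. integrable lborel (\<lambda>x. norm (F (Complex x y)) powr enn2real p)) \<and>
           bdd_above (line_norm (enn2real p) F ` {0<..}))}"

definition hardy_norm :: "ennreal \<Rightarrow> (complex \<Rightarrow> complex) \<Rightarrow> real" where
  "hardy_norm p F =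
     (if p = \<infinity> then (SUP z\<in>upper_half_plane. norm (F z))
      else (SUP y\<in>{0<..}. line_norm (enn2real p) F y))"

definition hardy_sobolev_space :: "nat \<Rightarrow> ennreal \<Rightarrow> (complex \<Rightarrow> complex) set" where
  "hardy_sobolev_space m p =
     {F. F holomorphic_on upper_half_plane \<and> (\<forall>k\<le>m. (deriv ^^ k) F \<in> hardy_space p)}"

definition hardy_sobolev_norm :: "nat \<Rightarrow> ennreal \<Rightarrow> (complex \<Rightarrow> complex) \<Rightarrow> real" where
  "hardy_sobolev_norm m p F =
     (if p = \<infinity> then (\<Sum>k\<le>m. hardy_norm p ((deriv ^^ k) F))
      else (\<Sum>k\<le>m. hardy_norm p ((deriv ^^ k) F) powr enn2real p) powr (1 / enn2real p))"

definition weighted_composition ::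
  "(complex \<Rightarrow> complex) \<Rightarrow> (complex \<Rightarrow> complex) \<Rightarrow> (complex \<Rightarrow> complex) \<Rightarrow> complex \<Rightarrow> complex" where
  "weighted_composition \<psi> \<phi> F = (\<lambda>z. \<psi> z * F (\<phi> z))"

text \<open>
  Boundedness of an operator given by a formula includes that it maps the space into itself.
\<close>

definition bounded_on_hardy_sobolev ::
  "nat \<Rightarrow> ennreal \<Rightarrow> ((complex \<Rightarrow> complex) \<Rightarrow> complex \<Rightarrow> complex) \<Rightarrow> bool" where
  "bounded_on_hardy_sobolev m p T \<longleftrightarrow>
     (\<forall>F\<in>hardy_sobolev_space m p. T F \<in> hardy_sobolev_space m p) \<and>
     (\<exists>C. \<forall>F\<in>hardy_sobolev_space m p.
        hardy_sobolev_norm m p (T F) \<le> C * hardy_sobolev_norm m p F)"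

end

theory Submission
  imports Defs "HOL-Probability.Sinc_Integral"
begin

text \<open>
  The proof has an analytic part, boundedness of \<open>F \<mapsto> F \<circ> \<phi>\<close> on \<open>H\<^sup>p\<close>, and an algebraic
  part that lifts it to derivatives by the Leibniz and chain rules.

  Composition for \<open>p < \<infinity>\<close>. A function \<open>F\<close> in \<open>H\<^sup>p\<close> is bounded on every half-plane
  \<open>Im z \<ge> \<epsilon>\<close>, so there it is the Poisson integral of its values on the line \<open>Im z = \<epsilon>\<close>,
  and convexity of \<open>s \<mapsto> s\<^sup>p\<close> gives
  \<open>\<bar>F (\<phi> z)\<bar>\<^sup>p \<le> \<integral> P (\<phi> z - i\<epsilon>, t) \<bar>F (t + i\<epsilon>)\<bar>\<^sup>p dt\<close>. By Tonelli it is enough to bound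
  \<open>\<integral> P (\<phi> (x + iy) - i\<epsilon>, t) dx\<close> uniformly in \<open>t\<close>. As a function of \<open>z\<close>, the kernel
  \<open>P (\<phi> z - i\<epsilon>, t)\<close> is \<open>1 / \<pi>\<close> times the real part of \<open>i / (\<phi> z - i\<epsilon> - t)\<close>, which is nonnegative.
  The integral over a line of a nonnegative real part of a bounded holomorphic function is controlled
  by its growth at \<open>i\<infinity>\<close> (\<open>nn_integral_Re_boundary_le\<close>), and the finite angular derivative,
  \<open>Im z \<le> C Im (\<phi> z)\<close>, makes this function at most \<open>C / Y\<close> at height \<open>Y\<close>
  above the line. This yields the operator bound in \<open>hardy_bound_composition\<close>.

  Derivatives. Since \<open>(F \<circ> \<phi>)' = \<phi>' \<cdot> (F' \<circ> \<phi>)\<close> and multiplication by a function of \<open>H\<^sub>m\<^sup>\<infinity>\<close> is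
  bounded on \<open>H\<^sub>m\<^sup>p\<close>, induction shows that composition with \<open>\<phi>\<close> is bounded on \<open>H\<^sub>n\<^sup>p\<close>. It
  remains to multiply by \<open>\<psi>\<close>. If \<open>\<psi>\<close> is in \<open>H\<^sub>n\<^sup>\<infinity>\<close> this is the multiplier bound again. If
  \<open>\<psi>\<close> is in \<open>H\<^sub>n\<^sup>p\<close>, the point is that \<open>H\<^sub>n\<^sup>p\<close> is an algebra for \<open>n \<ge> 1\<close>: by the Sobolev embedding of
  \<open>H\<^sub>1\<^sup>p\<close> into \<open>H\<^sup>\<infinity>\<close>, in each term \<open>\<psi>\<^bsup>(i)\<^esup> G\<^bsup>(j)\<^esup>\<close> of the Leibniz formula one factor is bounded.

  Both the embedding and the boundedness of \<open>F\<close> on \<open>Im z \<ge> \<epsilon>\<close> rest on one estimate: if \<open>A' = F\<close>,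
  then a horizontal increment of \<open>A\<close> over length at most \<open>1\<close> is at most \<open>\<parallel>F\<parallel>\<^sub>p\<close>.
\<close>

section \<open>The Poisson formula in the half-plane\<close>

definition poisson_kernel :: "complex \<Rightarrow> real \<Rightarrow> real" where
  "poisson_kernel w t = Im w / (pi * (norm (w - of_real t))\<^sup>2)"

text \<open>
  Cauchy's formula on the rectangle with vertices \<open>\<plusminus>R\<close>, \<open>\<plusminus>R + iR\<close>, applied to
  \<open>f z \<cdot> (Im w / \<pi>) / (z - cnj w)\<close>. The pole \<open>cnj w\<close> lies outside, on the real side the integrand is
  the Poisson integrand, and on the three other sides, of total length \<open>4 R\<close>, it is \<open>O(R\<^sup>-\<^sup>2)\<close>
  because \<open>f\<close> is bounded.
\<close>

lemma poisson_rectangle_estimate: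
  assumes f: "f holomorphic_on {z. - a < Im z}" and a: "0 < a"
    and B: "\<And>z. 0 \<le> Im z \<Longrightarrow> norm (f z) \<le> B"
    and w: "0 < Im w" and R: "2 * norm w < R"
  shows "norm (integral {-R..R} (\<lambda>t. poisson_kernel w t *\<^sub>R f (of_real t)) - f w)
           \<le> 16 * B * Im w / (pi * R)"
proof -
  define h where "h z = f z * of_real (Im w / pi) / (z - cnj w)" for z
  define S where "S = {z. - min a (Im w) < Im z}"
  define k where "k z = h z / (z - w)" for z
  have wR: "norm w < R" "0 < R" "\<bar>Re w\<bar> < R" "Im w < R"
    using R norm_ge_zero[of w] abs_Re_le_cmod[of w] abs_Im_le_cmod[of w] by linarith+
  have B0: "0 \<le> B" using order_trans[OF norm_ge_zero B[of 0]] by simp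
  have S: "convex S" "open S" "w \<in> S"
    using w a unfolding S_def
    by (auto simp: convex_halfspace_Im_gt open_halfspace_Im_gt)
  have "z \<noteq> cnj w" if "z \<in> S" for z using that by (auto simp: S_def)
  then have holh: "h holomorphic_on S"
    unfolding h_def
    by (intro holomorphic_intros holomorphic_on_subset[OF f]) (auto simp: S_def)
  have wb: "w \<in> box (of_real (-R)) (Complex R R)"
    using w wR by (auto simp: in_box_complex_iff)
  have img: "path_image (rectpath (of_real (-R)) (Complex R R)) \<subseteq> S - {w}"
    using w wR a by (subst path_image_rectpath) (auto simp: S_def)
  have "(k has_contour_integral
          2 * pi * \<i> * winding_number (rectpath (of_real (-R)) (Complex R R)) w * h w)
        (rectpath (of_real (-R)) (Complex R R))"
    unfolding k_def
    by (rule Cauchy_integral_formula_convex_simple[OF S(1) holh _ _ img])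
       (use S in \<open>auto simp: interior_open\<close>)
  moreover have "2 * of_real pi * \<i> * h w = f w"
  proof -
    have "w - cnj w = 2 * \<i> * of_real (Im w)" by (simp add: complex_eq_iff)
    then show ?thesis using w by (simp add: h_def)
  qed
  ultimately have k: "(k has_contour_integral f w) (rectpath (of_real (-R)) (Complex R R))"
    by (simp add: winding_number_rectpath[OF wb] del: of_real_minus)
  have cont: "continuous_on (S - {w}) k"
    unfolding k_def
    by (intro continuous_intros holomorphic_on_imp_continuous_on holomorphic_on_subset[OF holh]) auto
  have ci: "k contour_integrable_on (linepath u v)" if "closed_segment u v \<subseteq> S - {w}" for u v
    using that by (intro contour_integrable_continuous_linepath continuous_on_subset[OF cont])
  define a1 a2 a3 a4 where "a1 = complex_of_real (-R)" and "a2 = complex_of_real R"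
    and "a3 = Complex R R" and "a4 = Complex (-R) R"
  have seg: "closed_segment a1 a2 \<subseteq> S - {w}" "closed_segment a2 a3 \<subseteq> S - {w}"
     "closed_segment a3 a4 \<subseteq> S - {w}" "closed_segment a4 a1 \<subseteq> S - {w}"
    using w wR a by (auto simp: S_def a1_def a2_def a3_def a4_def closed_segment_same_Re
       closed_segment_same_Im closed_segment_eq_real_ivl)
  have rect: "rectpath (of_real (-R)) (Complex R R) =
      linepath a1 a2 +++ linepath a2 a3 +++ linepath a3 a4 +++ linepath a4 a1"
    by (simp add: rectpath_def a1_def a2_def a3_def a4_def Complex_eq Let_def)
  have ks: "k contour_integrable_on linepath a1 a2" "k contour_integrable_on linepath a2 a3"
    "k contour_integrable_on linepath a3 a4" "k contour_integrable_on linepath a4 a1"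
    using ci seg by auto
  have sum: "f w = contour_integral (linepath a1 a2) k + (contour_integral (linepath a2 a3) k
      + (contour_integral (linepath a3 a4) k + contour_integral (linepath a4 a1) k))"
    using contour_integral_unique[OF k] ks unfolding rect by simp
  define D where "D = 4 * B * Im w / (pi * R\<^sup>2)"
  have D0: "0 \<le> D" using B0 w by (simp add: D_def)
  \<comment> \<open>Off the real axis the contour stays at distance at least \<open>R\<close> from the origin.\<close>
  have kb: "norm (k z) \<le> D" if z: "0 \<le> Im z" "R \<le> norm z" for z
  proof -
    have 1: "R / 2 \<le> norm (z - w)" using norm_triangle_ineq2[of z w] z R by linarith
    have 2: "R / 2 \<le> norm (z - cnj w)" using norm_triangle_ineq2[of z "cnj w"] z R by simp
    have "norm (k z) = norm (f z) * (Im w / pi) / (norm (z - cnj w) * norm (z - w))"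
      using w by (simp add: k_def h_def norm_mult norm_divide)
    also have "\<dots> \<le> B * (Im w / pi) / ((R / 2) * (R / 2))"
      using B[OF z(1)] B0 w 1 2 wR by (intro frac_le mult_mono mult_nonneg_nonneg) auto
    also have "\<dots> = D" by (simp add: D_def power2_eq_square field_simps)
    finally show ?thesis .
  qed
  have "norm (contour_integral (linepath a2 a3) k) \<le> D * norm (a3 - a2)"
  proof (rule contour_integral_bound_linepath[OF ks(2) D0])
    fix z assume "z \<in> closed_segment a2 a3"
    then have "Re z = R" "0 \<le> Im z" using wR by (auto simp: a2_def a3_def closed_segment_same_Re closed_segment_eq_real_ivl)
    then show "norm (k z) \<le> D" using kb abs_Re_le_cmod[of z] by auto
  qed
  moreover have "norm (contour_integral (linepath a3 a4) k) \<le> D * norm (a4 - a3)"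
  proof (rule contour_integral_bound_linepath[OF ks(3) D0])
    fix z assume "z \<in> closed_segment a3 a4"
    then have "Im z = R" using wR by (auto simp: a4_def a3_def closed_segment_same_Im)
    then show "norm (k z) \<le> D" using kb abs_Im_le_cmod[of z] wR by auto
  qed
  moreover have "norm (contour_integral (linepath a4 a1) k) \<le> D * norm (a1 - a4)"
  proof (rule contour_integral_bound_linepath[OF ks(4) D0])
    fix z assume "z \<in> closed_segment a4 a1"
    then have "Re z = -R" "0 \<le> Im z" using wR by (auto simp: a4_def a1_def closed_segment_same_Re closed_segment_eq_real_ivl)
    then show "norm (k z) \<le> D" using kb abs_Re_le_cmod[of z] by auto
  qed
  moreover have "norm (a3 - a2) = R" "norm (a4 - a3) = 2 * R" "norm (a1 - a4) = R"
    using wR by (auto simp: a1_def a2_def a3_def a4_def cmod_def real_sqrt_mult)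
  ultimately have "norm (contour_integral (linepath a2 a3) k + (contour_integral (linepath a3 a4) k
      + contour_integral (linepath a4 a1) k)) \<le> D * (4 * R)"
    by (intro order_trans[OF norm_triangle_ineq] order_trans[OF add_left_mono[OF norm_triangle_ineq]]) auto
  moreover have "contour_integral (linepath a1 a2) k
      = integral {-R..R} (\<lambda>t. poisson_kernel w t *\<^sub>R f (of_real t))"
  proof -
    have "k (of_real t) = poisson_kernel w t *\<^sub>R f (of_real t)" for t
    proof -
      have "(of_real t - cnj w) * (of_real t - w) = of_real ((norm (w - of_real t))\<^sup>2)"
        using complex_norm_square[of "w - of_real t"] by (simp add: algebra_simps)
      then have "k (of_real t) = f (of_real t) * of_real (Im w / pi) / of_real ((norm (w - of_real t))\<^sup>2)"
        by (simp add: k_def h_def)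
      then show ?thesis by (simp add: poisson_kernel_def scaleR_conv_of_real)
    qed
    then show ?thesis
      using contour_integral_linepath_Reals_eq[of a1 a2 k] wR by (simp add: a1_def a2_def)
  qed
  ultimately have "norm (integral {-R..R} (\<lambda>t. poisson_kernel w t *\<^sub>R f (of_real t)) - f w) \<le> D * (4 * R)"
    using sum by (metis add_diff_cancel_left' norm_minus_commute)
  also have "\<dots> = 16 * B * Im w / (pi * R)"
    using wR by (simp add: D_def power2_eq_square field_simps)
  finally show ?thesis .
qed

lemma poisson_kernel_nonneg: "0 < Im w \<Longrightarrow> 0 \<le> poisson_kernel w t"
  by (simp add: poisson_kernel_def)

lemma continuous_poisson_kernel:
  assumes "continuous_on S u" "continuous_on S v" "\<And>x. x \<in> S \<Longrightarrow> 0 < Im (u x)"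
  shows "continuous_on S (\<lambda>x. poisson_kernel (u x) (v x))"
proof -
  have "norm (u x - of_real (v x)) \<noteq> 0" if "x \<in> S" for x
    using assms(3)[OF that] by (auto simp: complex_eq_iff)
  then show ?thesis unfolding poisson_kernel_def
    by (intro continuous_intros assms) auto
qed

lemma integrable_poisson_kernel:
  assumes w: "0 < Im w"
  shows "integrable lborel (poisson_kernel w)"
proof -
  have "integrable lborel (\<lambda>x::real. inverse (1 + x\<^sup>2))"
    using integrable_inverse_1_plus_square by (simp add: set_integrable_def)
  from lborel_integrable_real_affine[OF this, of "1 / Im w" "- Re w / Im w"]
  have "integrable lborel (\<lambda>t. 1 / (pi * Im w) * inverse (1 + (- Re w / Im w + 1 / Im w * t)\<^sup>2))"
    using w by simp
  moreover have "1 / (pi * Im w) * inverse (1 + (- Re w / Im w + 1 / Im w * t)\<^sup>2) = poisson_kernel w t" for t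
  proof -
    have "(norm (w - of_real t))\<^sup>2 = (Re w - t)\<^sup>2 + (Im w)\<^sup>2" by (simp add: cmod_power2)
    also have "\<dots> = (Im w)\<^sup>2 * (1 + (- Re w / Im w + 1 / Im w * t)\<^sup>2)"
      using w by (simp add: field_simps power2_eq_square)
    finally show ?thesis using w unfolding poisson_kernel_def
      by (simp only:) (simp add: power2_eq_square divide_simps)
  qed
  ultimately show ?thesis by simp
qed

text \<open>
  Boundedness of \<open>f\<close> makes the Poisson integrand absolutely integrable, so the rectangle estimate
  may be passed to the limit \<open>R \<rightarrow> \<infinity>\<close>.
\<close>

lemma
  assumes f: "f holomorphic_on {z. - a < Im z}" and a: "0 < a"
    and B: "\<And>z. 0 \<le> Im z \<Longrightarrow> norm (f z) \<le> B" and w: "0 < Im w"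
  shows integrable_poisson: "integrable lborel (\<lambda>t. poisson_kernel w t *\<^sub>R f (of_real t))"
    and poisson_formula: "(LINT t|lborel. poisson_kernel w t *\<^sub>R f (of_real t)) = f w"
proof -
  let ?g = "\<lambda>t. poisson_kernel w t *\<^sub>R f (of_real t)"
  have "continuous_on UNIV (\<lambda>t::real. f (of_real t))"
    by (rule continuous_on_compose2[OF holomorphic_on_imp_continuous_on[OF f]])
       (use a in \<open>auto intro!: continuous_intros\<close>)
  then have contg: "continuous_on UNIV ?g"
    using w by (intro continuous_intros continuous_poisson_kernel) auto
  have "integrable lborel (\<lambda>t. B * poisson_kernel w t)"
    using integrable_poisson_kernel[OF w] by simp
  then show int: "integrable lborel ?g"
  proof (rule Bochner_Integration.integrable_bound)
    show "?g \<in> borel_measurable lborel"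
      using contg borel_measurable_continuous_onI by auto
    have "norm (?g t) \<le> norm (B * poisson_kernel w t)" for t
    proof -
      have "norm (?g t) \<le> B * poisson_kernel w t"
        using mult_right_mono[OF B[of "of_real t"] poisson_kernel_nonneg[OF w, of t]]
          poisson_kernel_nonneg[OF w, of t] by (simp add: mult.commute)
      also have "\<dots> \<le> norm (B * poisson_kernel w t)" by simp
      finally show ?thesis .
    qed
    then show "AE t in lborel. norm (?g t) \<le> norm (B * poisson_kernel w t)" by simp
  qed
  have "(\<lambda>n. LINT t|lborel. indicator {-real n..real n} t *\<^sub>R ?g t) \<longlonglongrightarrow> (LINT t|lborel. ?g t)"
  proof (rule integral_dominated_convergence[where w = "\<lambda>t. norm (?g t)"])
    show "AE t in lborel. (\<lambda>n. indicator {-real n..real n} t *\<^sub>R ?g t) \<longlonglongrightarrow> ?g t"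
    proof (rule AE_I2)
      fix t :: real
      obtain n0 where "\<bar>t\<bar> \<le> real n0" using real_arch_simple by blast
      then have "eventually (\<lambda>n. indicator {-real n..real n} t *\<^sub>R ?g t = ?g t) sequentially"
        unfolding eventually_sequentially by (intro exI[of _ n0]) (auto simp: indicator_def)
      then show "(\<lambda>n. indicator {-real n..real n} t *\<^sub>R ?g t) \<longlonglongrightarrow> ?g t"
        by (rule tendsto_eventually)
    qed
    show [measurable]: "?g \<in> borel_measurable lborel" using int by auto
    show "(\<lambda>t. indicator {-real n..real n} t *\<^sub>R ?g t) \<in> borel_measurable lborel" for n
      by measurable
    show "integrable lborel (\<lambda>t. norm (?g t))" using int by (rule integrable_norm)
  qed (auto simp: indicator_def)
  moreover have "(LINT t|lborel. indicator {-real n..real n} t *\<^sub>R ?g t) = integral {-real n..real n} ?g" for n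
  proof -
    have "set_integrable lborel {-real n..real n} ?g"
      using int unfolding set_integrable_def by (intro integrable_mult_indicator) auto
    from set_borel_integral_eq_integral(2)[OF this] show ?thesis
      by (simp add: set_lebesgue_integral_def)
  qed
  ultimately have 1: "(\<lambda>n. integral {-real n..real n} ?g) \<longlonglongrightarrow> (LINT t|lborel. ?g t)" by simp
  have "(\<lambda>n. 16 * B * Im w / (pi * real n)) \<longlonglongrightarrow> 0" by real_asymp
  then have "(\<lambda>n. integral {-real n..real n} ?g - f w) \<longlonglongrightarrow> 0"
  proof (rule Lim_null_comparison[rotated])
    obtain n0 where n0: "2 * norm w < real n0" using reals_Archimedean2 by blast
    show "\<forall>\<^sub>F n in sequentially. norm (integral {-real n..real n} ?g - f w) \<le> 16 * B * Im w / (pi * real n)"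
      unfolding eventually_sequentially
    proof (intro exI[of _ n0] allI impI)
      fix n assume "n0 \<le> n"
      then have "2 * norm w < real n" using n0 by linarith
      from poisson_rectangle_estimate[OF f a B w this]
      show "norm (integral {-real n..real n} ?g - f w) \<le> 16 * B * Im w / (pi * real n)" .
    qed
  qed
  then have "(\<lambda>n. integral {-real n..real n} ?g) \<longlonglongrightarrow> f w"
    by (simp add: LIM_zero_iff)
  with 1 show "(LINT t|lborel. ?g t) = f w" using LIMSEQ_unique by blast
qed

text \<open>
  The kernel has mass one because the Poisson formula reproduces the constant \<open>1\<close>.
\<close>

lemma LINT_poisson_kernel:
  assumes "0 < Im w"
  shows "(LINT t|lborel. poisson_kernel w t) = 1"
proof -
  have "(LINT t|lborel. poisson_kernel w t *\<^sub>R (1::complex)) = 1"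
    by (rule poisson_formula[where f = "\<lambda>_. 1" and a = 1 and B = 1]) (use assms in auto)
  then have "complex_of_real (LINT t|lborel. poisson_kernel w t) = 1"
    by (simp add: scaleR_conv_of_real)
  then show ?thesis by simp
qed

text \<open>
  The convex function \<open>a \<mapsto> a\<^sup>q\<close> lies above its tangent at \<open>b\<close>, written without division so that \<open>b = 0\<close>
  is included. Integrated, this inequality yields both Jensen's inequality for the Poisson
  kernel and Hoelder's inequality on an interval of length at most one.
\<close>

lemma powr_above_tangent:
  fixes a b q :: real
  assumes "0 \<le> a" "0 \<le> b" "1 \<le> q"
  shows "q * a * b powr (q - 1) \<le> a powr q + (q - 1) * b powr q"
proof (cases "a = 0 \<or> b = 0")
  case True then show ?thesis using assms by auto
next
  case False
  then have ab: "0 < a" "0 < b" using assms by auto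
  have "(a powr q) powr (1/q) * (b powr q) powr (1 - 1/q) \<le> 1/q * a powr q + (1 - 1/q) * b powr q"
    using assms ab by (intro Youngs_inequality_0) auto
  moreover have "(a powr q) powr (1/q) = a" "(b powr q) powr (1 - 1/q) = b powr (q - 1)"
    using assms ab by (auto simp: powr_powr algebra_simps)
  ultimately have "q * (a * b powr (q - 1)) \<le> q * (1/q * a powr q + (1 - 1/q) * b powr q)"
    using assms by (intro mult_left_mono) auto
  also have "\<dots> = a powr q + (q - 1) * b powr q"
    using assms by (simp add: field_simps)
  finally show ?thesis by (simp add: mult.assoc)
qed

text \<open>
  Jensen's inequality for the probability density \<open>P\<close>: integrate the tangent inequality at \<open>b = \<bar>f w\<bar>\<close>
  against \<open>P\<close> and use \<open>b \<le> \<integral> P \<bar>f\<bar>\<close>.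
\<close>

lemma norm_powr_le_poisson_integral:
  assumes f: "f holomorphic_on {z. - a < Im z}" and a: "0 < a"
    and B: "\<And>z. 0 \<le> Im z \<Longrightarrow> norm (f z) \<le> B" and w: "0 < Im w" and q: "1 \<le> q"
  shows "ennreal (norm (f w) powr q)
    \<le> (\<integral>\<^sup>+t. ennreal (poisson_kernel w t * norm (f (of_real t)) powr q) \<partial>lborel)"
proof -
  let ?P = "poisson_kernel w" and ?b = "norm (f w)"
  let ?n = "\<lambda>t. norm (f (of_real t))"
  have P0: "0 \<le> ?P t" for t using w by (rule poisson_kernel_nonneg)
  have P: "integrable lborel ?P" using w by (rule integrable_poisson_kernel)
  have cont: "continuous_on UNIV (\<lambda>t::real. f (of_real t))"
    by (rule continuous_on_compose2[OF holomorphic_on_imp_continuous_on[OF f]])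
       (use a in \<open>auto intro!: continuous_intros\<close>)
  have contP: "continuous_on UNIV ?P"
    using continuous_poisson_kernel[of UNIV "\<lambda>_. w" "\<lambda>t. t"] w by simp
  have int1: "integrable lborel (\<lambda>t. ?P t * ?n t)"
    using integrable_norm[OF integrable_poisson[OF f a B w]] P0 by simp
  have int2: "integrable lborel (\<lambda>t. ?P t * ?n t powr q)"
  proof (rule Bochner_Integration.integrable_bound[of _ "\<lambda>t. B powr q * ?P t"])
    show "(\<lambda>t. ?P t * ?n t powr q) \<in> borel_measurable lborel"
      using contP cont q
      by (simp, intro borel_measurable_continuous_onI continuous_intros continuous_on_powr') auto
    have "norm (?P t * ?n t powr q) \<le> norm (B powr q * ?P t)" for t
      using P0[of t] powr_mono2[of q "?n t" B] B[of "of_real t"] q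
      by (simp add: abs_mult mult.commute mult_left_mono)
    then show "AE t in lborel. norm (?P t * ?n t powr q) \<le> norm (B powr q * ?P t)" by simp
  qed (use P in auto)
  have "?b = norm (LINT t|lborel. ?P t *\<^sub>R f (of_real t))"
    using poisson_formula[OF f a B w] by simp
  also have "\<dots> \<le> (LINT t|lborel. norm (?P t *\<^sub>R f (of_real t)))" by (rule integral_norm_bound)
  also have "\<dots> = (LINT t|lborel. ?P t * ?n t)" using P0 by simp
  finally have b: "?b \<le> (LINT t|lborel. ?P t * ?n t)" .
  have "q * ?b powr q = q * ?b powr (q - 1) * ?b"
    using powr_mult_base[of ?b "q - 1"] by (simp add: mult.commute)
  also have "\<dots> \<le> q * ?b powr (q - 1) * (LINT t|lborel. ?P t * ?n t)"
    using b q by (intro mult_left_mono) auto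
  also have "\<dots> = (LINT t|lborel. ?P t * (q * ?n t * ?b powr (q - 1)))"
    by (subst integral_mult_right_zero[symmetric]) (simp add: algebra_simps)
  also have "\<dots> \<le> (LINT t|lborel. ?P t * ?n t powr q + (q - 1) * ?b powr q * ?P t)"
  proof (rule integral_mono)
    show "integrable lborel (\<lambda>t. ?P t * (q * ?n t * ?b powr (q - 1)))"
      using integrable_mult_right[OF int1, of "q * ?b powr (q - 1)"] by (simp add: algebra_simps)
    show "integrable lborel (\<lambda>t. ?P t * ?n t powr q + (q - 1) * ?b powr q * ?P t)"
      using int2 P by (intro Bochner_Integration.integrable_add) auto
    show "?P t * (q * ?n t * ?b powr (q - 1)) \<le> ?P t * ?n t powr q + (q - 1) * ?b powr q * ?P t" for t
      using mult_left_mono[OF powr_above_tangent[of "?n t" ?b q] P0[of t]] q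
      by (simp add: algebra_simps)
  qed
  also have "\<dots> = (LINT t|lborel. ?P t * ?n t powr q) + (q - 1) * ?b powr q"
    using int2 P LINT_poisson_kernel[OF w] by simp
  finally have "?b powr q \<le> (LINT t|lborel. ?P t * ?n t powr q)"
    by (simp add: algebra_simps)
  then show ?thesis
    using nn_integral_eq_integral[OF int2] P0 by simp
qed

section \<open>Size estimates for Hardy functions\<close>

text \<open>
  Membership in \<open>H\<^sup>p\<close> together with the norm bound \<open>N\<close>. The line integrals are taken in the extended
  nonnegative reals, so that a finite upper bound already contains integrability.
\<close>

definition hardy_bound :: "ennreal \<Rightarrow> (complex \<Rightarrow> complex) \<Rightarrow> real \<Rightarrow> bool" where
  "hardy_bound p F N \<longleftrightarrow> F holomorphic_on upper_half_plane \<and> 0 \<le> N \<and>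
     (if p = \<infinity> then \<forall>z\<in>upper_half_plane. norm (F z) \<le> N
      else \<forall>y>0. (\<integral>\<^sup>+x. ennreal (norm (F (Complex x y)) powr enn2real p) \<partial>lborel)
             \<le> ennreal (N powr enn2real p))"

lemma open_upper_half_plane: "open upper_half_plane"
  and convex_upper_half_plane: "convex upper_half_plane"
  by (simp_all add: upper_half_plane_def open_halfspace_Im_gt convex_halfspace_Im_gt)

lemma one_le_enn2real: "1 \<le> p \<Longrightarrow> p \<noteq> \<infinity> \<Longrightarrow> 1 \<le> enn2real p"
  using enn2real_mono[of 1 p] by (simp add: less_top)

lemma continuous_on_horizontal_line:
  assumes "F holomorphic_on upper_half_plane" "0 < y"
  shows "continuous_on S (\<lambda>x. F (Complex x y))"
  by (rule continuous_on_compose2[OF holomorphic_on_imp_continuous_on[OF assms(1)]])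
     (use assms in \<open>auto intro!: continuous_intros simp: upper_half_plane_def Complex_eq\<close>)

lemma has_integral_horizontal:
  assumes A: "\<And>z. z \<in> upper_half_plane \<Longrightarrow> (A has_field_derivative F z) (at z)"
    and "0 < y" "a \<le> b"
  shows "((\<lambda>x. F (Complex x y)) has_integral (A (Complex b y) - A (Complex a y))) {a..b}"
proof (rule fundamental_theorem_of_calculus[OF assms(3)])
  fix x
  have "((\<lambda>s. Complex s y) has_vector_derivative 1) (at x within {a..b})"
    unfolding Complex_eq by (auto intro!: derivative_eq_intros simp: has_vector_derivative_def scaleR_conv_of_real)
  then show "((\<lambda>s. A (Complex s y)) has_vector_derivative F (Complex x y)) (at x within {a..b})"
    using field_vector_diff_chain_within[of "\<lambda>s. Complex s y" 1 x "{a..b}" A "F (Complex x y)"]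
      has_field_derivative_at_within[OF A] assms(2)
    by (simp add: upper_half_plane_def o_def)
qed

text \<open>
  The increment is \<open>\<integral> F\<close> over an interval of length at most one, hence at most \<open>\<integral> \<bar>F\<bar>\<close>, which the
  tangent inequality at height \<open>M\<close> bounds by \<open>M\<close> as soon as \<open>\<integral> \<bar>F\<bar>\<^sup>q \<le> M\<^sup>q\<close>. That argument divides by
  \<open>M\<close>; it is applied to all \<open>M > N\<close> so that \<open>N = 0\<close> is covered.
\<close>

lemma norm_increment_le:
  assumes A: "\<And>z. z \<in> upper_half_plane \<Longrightarrow> (A has_field_derivative F z) (at z)"
    and F: "hardy_bound p F N" and p: "1 \<le> p" "p \<noteq> \<infinity>"
    and y: "0 < y" and ab: "a \<le> b" "b \<le> a + 1"
  shows "norm (A (Complex b y) - A (Complex a y)) \<le> N"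
proof (rule dense_ge)
  fix M assume "N < M"
  then have M: "0 < M" "N \<le> M" using F by (auto simp: hardy_bound_def)
  define q where "q = enn2real p"
  have q: "1 \<le> q" using one_le_enn2real[OF p] by (simp add: q_def)
  let ?g = "\<lambda>x. norm (F (Complex x y))"
  have cF: "continuous_on {a..b} (\<lambda>x. F (Complex x y))"
    using F y by (intro continuous_on_horizontal_line) (auto simp: hardy_bound_def)
  then have ig: "?g integrable_on {a..b}"
    by (intro integrable_continuous_real continuous_intros)
  have ih: "(\<lambda>x. ?g x powr q) integrable_on {a..b}"
    using cF q by (intro integrable_continuous_real continuous_on_powr' continuous_intros) auto
  have "ennreal (integral {a..b} (\<lambda>x. ?g x powr q))
      = (\<integral>\<^sup>+x. ennreal (?g x powr q) * indicator {a..b} x \<partial>lborel)"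
    using nn_integral_has_integral_lebesgue'[OF _ integrable_integral[OF ih]] by simp
  also have "\<dots> \<le> (\<integral>\<^sup>+x. ennreal (?g x powr q) \<partial>lborel)"
    by (intro nn_integral_mono) (auto simp: indicator_def)
  also have "\<dots> \<le> ennreal (N powr q)" using F p y by (simp add: hardy_bound_def q_def)
  finally have "integral {a..b} (\<lambda>x. ?g x powr q) \<le> N powr q"
    by simp
  also have "\<dots> \<le> M powr q" using M q F by (intro powr_mono2) (auto simp: hardy_bound_def)
  finally have h: "integral {a..b} (\<lambda>x. ?g x powr q) \<le> M powr q" .
  have "q * M powr (q - 1) * norm (A (Complex b y) - A (Complex a y))
      \<le> q * M powr (q - 1) * integral {a..b} ?g"
    using integral_norm_bound_integral[OF _ ig, of "\<lambda>x. F (Complex x y)"]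
      has_integral_horizontal[OF A y ab(1)] q
    by (intro mult_left_mono) (auto simp: integral_unique integrable_on_def)
  also have "\<dots> = integral {a..b} (\<lambda>x. q * ?g x * M powr (q - 1))"
    by (subst integral_mult_right[symmetric]) (simp add: algebra_simps)
  also have "\<dots> \<le> integral {a..b} (\<lambda>x. ?g x powr q + (q - 1) * M powr q)"
    using cF q M ih
    by (intro integral_le integrable_continuous_real powr_above_tangent continuous_intros
          continuous_on_powr') auto
  also have "\<dots> = integral {a..b} (\<lambda>x. ?g x powr q) + (b - a) * ((q - 1) * M powr q)"
    using ih ab by (subst integral_add) auto
  also have "\<dots> \<le> M powr q + 1 * ((q - 1) * M powr q)"
    using h ab q by (intro add_mono mult_right_mono) auto
  also have "\<dots> = q * M powr (q - 1) * M"
    using powr_mult_base[of M "q - 1"] M by (simp add: algebra_simps)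
  finally show "norm (A (Complex b y) - A (Complex a y)) \<le> M"
    using q M by simp
qed

text \<open>
  A value of \<open>F\<close> is its mean over a unit interval, which is an increment of the primitive \<open>A\<close>, minus
  the mean of the differences of \<open>F\<close>.
\<close>

lemma norm_le_increments:
  assumes A: "\<And>z. z \<in> upper_half_plane \<Longrightarrow> (A has_field_derivative F z) (at z)"
    and y: "0 < y"
    and N: "norm (A (Complex (x + 1) y) - A (Complex x y)) \<le> N"
    and D: "\<And>s. x \<le> s \<Longrightarrow> s \<le> x + 1 \<Longrightarrow> norm (F (Complex s y) - F (Complex x y)) \<le> D"
  shows "norm (F (Complex x y)) \<le> N + D"
proof -
  let ?I = "A (Complex (x + 1) y) - A (Complex x y)"
  have "((\<lambda>s. F (Complex s y) - F (Complex x y)) has_integral (?I - (x + 1 - x) *\<^sub>R F (Complex x y))) {x..x+1}"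
    using has_integral_const_real[of "F (Complex x y)" x "x + 1"]
    by (intro has_integral_diff has_integral_horizontal[OF A y]) auto
  from has_integral_bound_real[OF _ _ this, of D "{}"] D D[of x]
  have "norm (?I - F (Complex x y)) \<le> D" by simp
  then show ?thesis
    using N norm_triangle_ineq2[of "F (Complex x y)" ?I] by (simp add: norm_minus_commute)
qed

text \<open>
  With a primitive \<open>A\<close> of \<open>F\<close>, differences of \<open>F\<close> are derivatives of the functions
  \<open>z \<mapsto> A (z + h) - A z\<close>, which are bounded by \<open>N\<close> when \<open>0 \<le> h \<le> 1\<close>. Cauchy's estimate on discs of radius \<open>\<epsilon> / 2\<close> therefore bounds these
  differences, and \<open>norm_le_increments\<close> applies.
\<close>

lemma hardy_bounded_above_height:
  assumes F: "hardy_bound p F N" and p: "1 \<le> p" and \<epsilon>: "0 < \<epsilon>"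
  obtains B where "\<And>z. \<epsilon> \<le> Im z \<Longrightarrow> norm (F z) \<le> B"
proof (cases "p = \<infinity>")
  case True
  then show ?thesis using F \<epsilon> that[of N] by (auto simp: hardy_bound_def upper_half_plane_def)
next
  case False
  have hol: "F holomorphic_on upper_half_plane" using F by (simp add: hardy_bound_def)
  obtain A where A: "\<And>z. z \<in> upper_half_plane \<Longrightarrow> (A has_field_derivative F z) (at z)"
    using holomorphic_convex_primitive'[OF convex_upper_half_plane open_upper_half_plane hol]
      at_within_open[OF _ open_upper_half_plane] by metis
  define D where "D = (N + 1) / (\<epsilon> / 2)"
  have D: "norm (F (Complex s y) - F (Complex x y)) \<le> D"
    if s: "x \<le> s" "s \<le> x + 1" and y: "\<epsilon> \<le> y" for s x y
  proof -
    define G where "G z = A (z + of_real (s - x)) - A z" for z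
    have up: "z + of_real (s - x) \<in> upper_half_plane" if "z \<in> upper_half_plane" for z
      using that by (simp add: upper_half_plane_def)
    have derG: "(G has_field_derivative F (z + of_real (s - x)) - F z) (at z)" if z: "z \<in> upper_half_plane" for z
    proof -
      have "((\<lambda>z. A (z + of_real (s - x))) has_field_derivative F (z + of_real (s - x))) (at z)"
        using A[OF up[OF z]] by (simp add: DERIV_shift)
      then show ?thesis unfolding G_def using A[OF z] by (intro DERIV_diff)
    qed
    have sub: "cball (Complex x y) (\<epsilon> / 2) \<subseteq> upper_half_plane"
    proof
      fix z assume "z \<in> cball (Complex x y) (\<epsilon> / 2)"
      then show "z \<in> upper_half_plane"
        using abs_Im_le_cmod[of "Complex x y - z"] y \<epsilon> by (simp add: dist_norm upper_half_plane_def)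
    qed
    have holG: "G holomorphic_on upper_half_plane"
      using derG holomorphic_on_open[OF open_upper_half_plane] by blast
    have "norm ((deriv ^^ 1) G (Complex x y)) \<le> fact 1 * (N + 1) / (\<epsilon> / 2) ^ 1"
    proof (rule Cauchy_higher_deriv_bound[where y = 0])
      show "G holomorphic_on ball (Complex x y) (\<epsilon> / 2)"
        using holomorphic_on_subset[OF holG] sub ball_subset_cball by blast
      show "continuous_on (cball (Complex x y) (\<epsilon> / 2)) G"
        using holomorphic_on_imp_continuous_on[OF holG] sub continuous_on_subset by blast
      fix w assume "w \<in> ball (Complex x y) (\<epsilon> / 2)"
      then have "w \<in> upper_half_plane" using sub by auto
      then have "norm (A (Complex (Re w + (s - x)) (Im w)) - A (Complex (Re w) (Im w))) \<le> N"
        using s by (intro norm_increment_le[OF A F p False]) (auto simp: upper_half_plane_def)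
      moreover have "w + of_real (s - x) = Complex (Re w + (s - x)) (Im w)" by (simp add: complex_eq_iff)
      ultimately show "G w \<in> ball 0 (N + 1)" by (simp add: G_def)
    qed (use \<epsilon> in auto)
    moreover have "deriv G (Complex x y) = F (Complex s y) - F (Complex x y)"
      using DERIV_imp_deriv[OF derG[of "Complex x y"]] y \<epsilon>
      by (simp add: upper_half_plane_def Complex_eq ac_simps)
    ultimately show ?thesis by (simp add: D_def)
  qed
  show ?thesis
  proof (rule that[of "N + D"])
    fix z assume z: "\<epsilon> \<le> Im z"
    have "norm (F (Complex (Re z) (Im z))) \<le> N + D"
      using z \<epsilon> D[of "Re z" _ "Im z"]
      by (intro norm_le_increments[OF A] norm_increment_le[OF A F p False]) auto
    then show "norm (F z) \<le> N + D" by simp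
  qed
qed

text \<open>
  For \<open>p < \<infinity>\<close>, differences of \<open>F\<close> are increments of a primitive of \<open>F'\<close>, namely \<open>F\<close>,
  so \<open>norm_increment_le\<close> bounds them by \<open>N\<close>, and \<open>norm_le_increments\<close> gives \<open>N + N\<close>.
\<close>

lemma hardy_sobolev_embedding:
  assumes F: "hardy_bound p F N" and F': "hardy_bound p (deriv F) N" and p: "1 \<le> p"
  shows "hardy_bound \<infinity> F (2 * N)"
proof (cases "p = \<infinity>")
  case True
  then show ?thesis using F by (auto simp: hardy_bound_def intro: order_trans)
next
  case False
  have hol: "F holomorphic_on upper_half_plane" and N: "0 \<le> N" using F by (auto simp: hardy_bound_def)
  obtain A where A: "\<And>z. z \<in> upper_half_plane \<Longrightarrow> (A has_field_derivative F z) (at z)"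
    using holomorphic_convex_primitive'[OF convex_upper_half_plane open_upper_half_plane hol]
      at_within_open[OF _ open_upper_half_plane] by metis
  have dF: "\<And>z. z \<in> upper_half_plane \<Longrightarrow> (F has_field_derivative deriv F z) (at z)"
    using holomorphic_derivI[OF hol open_upper_half_plane] .
  have "norm (F z) \<le> 2 * N" if z: "z \<in> upper_half_plane" for z
  proof -
    have "norm (F (Complex (Re z) (Im z))) \<le> N + N"
      using z
      by (intro norm_le_increments[OF A] norm_increment_le[OF A F p False]
          norm_increment_le[OF dF F' p False]) (auto simp: upper_half_plane_def)
    then show ?thesis by simp
  qed
  then show ?thesis using hol N by (auto simp: hardy_bound_def)
qed

section \<open>Composition with a self-map of finite angular derivative\<close>

lemma borel_measurable_ennreal_continuous:
  fixes f :: "real \<Rightarrow> real"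
  assumes "continuous_on UNIV f"
  shows "(\<lambda>x. ennreal (f x)) \<in> borel_measurable lborel"
  using measurable_compose[OF borel_measurable_continuous_onI[OF assms] measurable_ennreal] by simp

text \<open>
  The Poisson formula at \<open>iY\<close>, multiplied by \<open>\<pi>Y\<close>, reads
  \<open>\<integral> Y\<^sup>2 / (t\<^sup>2 + Y\<^sup>2) \<cdot> Re (f t) dt = \<pi> Y Re (f (iY)) \<le> \<pi> C\<close>. The weights tend to \<open>1\<close> as \<open>Y \<rightarrow> \<infinity>\<close>, and Fatou's lemma
  gives the claim because \<open>Re f\<close> is nonnegative on the line.
\<close>

lemma nn_integral_Re_boundary_le:
  assumes f: "f holomorphic_on {z. - a < Im z}" and a: "0 < a"
    and B: "\<And>z. 0 \<le> Im z \<Longrightarrow> norm (f z) \<le> B"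
    and pos: "\<And>t. 0 \<le> Re (f (of_real t))"
    and C: "\<And>Y. 0 < Y \<Longrightarrow> Y * norm (f (Complex 0 Y)) \<le> C"
  shows "(\<integral>\<^sup>+t. ennreal (Re (f (of_real t))) \<partial>lborel) \<le> ennreal (pi * C)"
proof -
  define Y where "Y n = real (Suc n)" for n
  define P where "P n = poisson_kernel (Complex 0 (Y n))" for n
  define u where "u n t = ennreal (pi * Y n * (P n t * Re (f (of_real t))))" for n t
  have Y: "0 < Y n" for n by (simp add: Y_def)
  have P0: "0 \<le> P n t" for n t unfolding P_def using Y by (intro poisson_kernel_nonneg) simp
  have int: "integrable lborel (\<lambda>t. P n t *\<^sub>R f (of_real t))" for n
    unfolding P_def using Y by (intro integrable_poisson[OF f a B]) auto
  have int': "integrable lborel (\<lambda>t. P n t * Re (f (of_real t)))" for n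
    using integrable_Re[OF int[of n]] by simp
  have le: "(\<integral>\<^sup>+t. u n t \<partial>lborel) \<le> ennreal (pi * C)" for n
  proof -
    have "(LINT t|lborel. P n t * Re (f (of_real t))) = Re (LINT t|lborel. P n t *\<^sub>R f (of_real t))"
      using integral_Re[OF int[of n]] by simp
    also have "\<dots> = Re (f (Complex 0 (Y n)))"
      unfolding P_def using Y by (subst poisson_formula[OF f a B]) auto
    finally have *: "(LINT t|lborel. P n t * Re (f (of_real t))) = Re (f (Complex 0 (Y n)))" .
    have "(\<integral>\<^sup>+t. u n t \<partial>lborel) = ennreal (LINT t|lborel. pi * Y n * (P n t * Re (f (of_real t))))"
      unfolding u_def using P0 pos Y[of n] int'[of n]
      by (intro nn_integral_eq_integral integrable_mult_right AE_I2 mult_nonneg_nonneg) auto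
    also have "\<dots> = ennreal (pi * (Y n * Re (f (Complex 0 (Y n)))))"
      by (simp add: * mult.assoc)
    also have "\<dots> \<le> ennreal (pi * C)"
      using order_trans[OF mult_left_mono[OF complex_Re_le_cmod] C[OF Y]] Y[of n]
      by (intro ennreal_leI mult_left_mono) (auto simp: less_imp_le)
    finally show ?thesis .
  qed
  have lim: "(\<lambda>n. u n t) \<longlonglongrightarrow> ennreal (Re (f (of_real t)))" for t
  proof -
    have "pi * Y n * P n t = (Y n)\<^sup>2 / (t\<^sup>2 + (Y n)\<^sup>2)" for n
    proof -
      have "(norm (Complex 0 (Y n) - of_real t))\<^sup>2 = t\<^sup>2 + (Y n)\<^sup>2" by (simp add: cmod_power2)
      then show ?thesis by (simp add: P_def poisson_kernel_def) (simp add: power2_eq_square)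
    qed
    moreover have "(\<lambda>n. (Y n)\<^sup>2 / (t\<^sup>2 + (Y n)\<^sup>2)) \<longlonglongrightarrow> 1"
      unfolding Y_def by real_asymp
    ultimately have "(\<lambda>n. pi * Y n * P n t) \<longlonglongrightarrow> 1" by simp
    then have "(\<lambda>n. pi * Y n * P n t * Re (f (of_real t))) \<longlonglongrightarrow> 1 * Re (f (of_real t))"
      by (rule tendsto_mult_right)
    then show ?thesis unfolding u_def by (intro tendsto_ennrealI) (simp add: mult.assoc)
  qed
  have "(\<integral>\<^sup>+t. ennreal (Re (f (of_real t))) \<partial>lborel) = (\<integral>\<^sup>+t. liminf (\<lambda>n. u n t) \<partial>lborel)"
    using lim_imp_Liminf[OF _ lim] by simp
  also have "\<dots> \<le> liminf (\<lambda>n. \<integral>\<^sup>+t. u n t \<partial>lborel)"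
    unfolding u_def using int' by (intro nn_integral_liminf) auto
  also have "\<dots> \<le> ennreal (pi * C)"
    using Liminf_le[of sequentially "\<lambda>n. \<integral>\<^sup>+t. u n t \<partial>lborel"] le by auto
  finally show ?thesis .
qed

text \<open>
  The finite angular derivative in the form \<open>Im z \<le> C Im (\<phi> z)\<close>. Taking \<open>C \<ge> 1\<close> lets the same \<open>C\<close>
  serve as operator bound for every \<open>p\<close>, since then \<open>C\<^bsup>1/p\<^esup> \<le> C\<close>.
\<close>

locale angular_self_map =
  fixes \<phi> :: "complex \<Rightarrow> complex" and C :: real
  assumes holomorphic: "\<phi> holomorphic_on upper_half_plane"
    and C_ge_1: "1 \<le> C"
    and Im_le: "\<And>z. z \<in> upper_half_plane \<Longrightarrow> Im z \<le> C * Im (\<phi> z)"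
begin

lemma Im_lower: "0 < Im z \<Longrightarrow> Im z / C \<le> Im (\<phi> z)"
  using Im_le[of z] C_ge_1 by (simp add: upper_half_plane_def field_simps)

lemma maps_into: "z \<in> upper_half_plane \<Longrightarrow> \<phi> z \<in> upper_half_plane"
proof -
  assume z: "z \<in> upper_half_plane"
  then have "0 < Im z / C" using C_ge_1 by (simp add: upper_half_plane_def)
  then show ?thesis using Im_lower[of z] z by (simp add: upper_half_plane_def)
qed

text \<open>
  \<open>nn_integral_Re_boundary_le\<close> for \<open>f z = i / (\<phi> (z + iy) - i\<epsilon> - t)\<close> with \<open>\<epsilon> = y / (2 C)\<close>. This shift is half the
  lower bound \<open>y / C\<close> for \<open>Im \<phi>\<close> on the line: the denominator keeps imaginary part at least
  \<open>(Im z + y / 2) / C\<close>, so \<open>f\<close> is holomorphic beyond the real line, bounded, and at most \<open>C / Y\<close> at \<open>iY\<close>.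
\<close>

lemma nn_integral_poisson_kernel_le:
  assumes y: "0 < y"
  shows "(\<integral>\<^sup>+x. ennreal (poisson_kernel (\<phi> (Complex x y) - \<i> * of_real (y / (2 * C))) t) \<partial>lborel)
           \<le> ennreal C"
proof -
  define w where "w z = \<phi> (z + \<i> * of_real y) - \<i> * of_real (y / (2 * C))" for z
  define f where "f z = \<i> / (w z - of_real t)" for z
  have C: "0 < C" using C_ge_1 by simp
  have Imw: "(Im z + y / 2) / C \<le> Im (w z)" if "- (y / 2) < Im z" for z
  proof -
    have "(Im z + y / 2) / C = (Im z + y) / C - y / (2 * C)"
      using C by (simp add: field_simps)
    then show ?thesis using Im_lower[of "z + \<i> * of_real y"] that y by (simp add: w_def)
  qed
  have norm_f: "norm (f z) \<le> C / (Im z + y / 2)" if "- (y / 2) < Im z" for z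
  proof -
    have p: "0 < (Im z + y / 2) / C" using that C by simp
    have "(Im z + y / 2) / C \<le> norm (w z - of_real t)"
      using Imw[OF that] abs_Im_le_cmod[of "w z - of_real t"] by simp
    then have "1 / norm (w z - of_real t) \<le> 1 / ((Im z + y / 2) / C)"
      using p by (intro divide_left_mono mult_pos_pos) linarith+
    then show ?thesis by (simp add: f_def norm_divide)
  qed
  have Imw0: "0 < Im (w z)" if "- (y / 2) < Im z" for z
  proof -
    have "0 < (Im z + y / 2) / C" using that C by simp
    then show ?thesis using Imw[OF that] by linarith
  qed
  have "(\<phi> \<circ> (\<lambda>z. z + \<i> * of_real y)) holomorphic_on {z. - (y / 2) < Im z}"
    by (rule holomorphic_on_compose_gen[OF _ holomorphic])
       (use y in \<open>auto intro!: holomorphic_intros simp: upper_half_plane_def\<close>)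
  then have "w holomorphic_on {z. - (y / 2) < Im z}"
    unfolding w_def by (intro holomorphic_intros) (simp add: o_def)
  moreover have "w z - of_real t \<noteq> 0" if "- (y / 2) < Im z" for z
    using Imw0[OF that] by (auto simp: complex_eq_iff)
  ultimately have hol: "f holomorphic_on {z. - (y / 2) < Im z}"
    unfolding f_def by (intro holomorphic_intros) auto
  have Re_f: "Re (f z) = pi * poisson_kernel (w z) t" for z
    by (simp add: f_def poisson_kernel_def Re_divide cmod_power2)
  have "(\<integral>\<^sup>+x. ennreal (Re (f (of_real x))) \<partial>lborel) \<le> ennreal (pi * C)"
  proof (rule nn_integral_Re_boundary_le[OF hol, of "C / (y / 2)"])
    show "norm (f z) \<le> C / (y / 2)" if "0 \<le> Im z" for z
    proof -
      have "norm (f z) \<le> C / (Im z + y / 2)" using norm_f that y by simp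
      also have "\<dots> \<le> C / (y / 2)" using that y C by (intro divide_left_mono) auto
      finally show ?thesis .
    qed
    show "0 \<le> Re (f (of_real x))" for x
      unfolding Re_f using Imw0[of "of_real x"] y by (simp add: poisson_kernel_nonneg)
    show "Y * norm (f (Complex 0 Y)) \<le> C" if Y: "0 < Y" for Y
    proof -
      have "norm (f (Complex 0 Y)) \<le> C / (Y + y / 2)" using norm_f[of "Complex 0 Y"] Y y by simp
      also have "\<dots> \<le> C / Y" using Y y C by (intro divide_left_mono) auto
      finally show ?thesis using Y by (simp add: field_simps)
    qed
  qed (use y in auto)
  moreover have "(\<integral>\<^sup>+x. ennreal (Re (f (of_real x))) \<partial>lborel)
      = ennreal pi * (\<integral>\<^sup>+x. ennreal (poisson_kernel (w (of_real x)) t) \<partial>lborel)"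
  proof (subst nn_integral_cmult[symmetric])
    have "continuous_on UNIV (\<lambda>x. w (of_real x))"
      unfolding w_def using continuous_on_horizontal_line[OF holomorphic y]
      by (intro continuous_intros) (simp add: Complex_eq)
    then have "continuous_on UNIV (\<lambda>x. poisson_kernel (w (of_real x)) t)"
      using Imw0 y by (intro continuous_poisson_kernel) auto
    then show "(\<lambda>x. ennreal (poisson_kernel (w (of_real x)) t)) \<in> borel_measurable lborel"
      by (rule borel_measurable_ennreal_continuous)
    show "(\<integral>\<^sup>+x. ennreal (Re (f (of_real x))) \<partial>lborel)
      = (\<integral>\<^sup>+x. ennreal pi * ennreal (poisson_kernel (w (of_real x)) t) \<partial>lborel)"
      unfolding Re_f using Imw0 y by (simp add: ennreal_mult poisson_kernel_nonneg)
  qed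
  ultimately have "ennreal pi * (\<integral>\<^sup>+x. ennreal (poisson_kernel (w (of_real x)) t) \<partial>lborel)
      \<le> ennreal pi * ennreal C"
    using C by (simp add: ennreal_mult)
  then have "(\<integral>\<^sup>+x. ennreal (poisson_kernel (w (of_real x)) t) \<partial>lborel) \<le> ennreal C"
    by (simp add: ennreal_mult_le_mult_iff)
  then show ?thesis by (simp add: w_def Complex_eq)
qed

text \<open>
  Insert the Poisson majorant of \<open>\<bar>F\<bar>\<^sup>q\<close> based on the line \<open>Im z = \<epsilon>\<close>, exchange the integrals by Tonelli,
  and integrate the kernel in \<open>x\<close> first. The choice of \<open>\<epsilon>\<close> keeps \<open>\<phi> (x + iy)\<close> strictly above that line.
\<close>

lemma nn_integral_composition_le:
  assumes F: "hardy_bound p F N" and p: "1 \<le> p" "p \<noteq> \<infinity>" and y: "0 < y"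
  shows "(\<integral>\<^sup>+x. ennreal (norm (F (\<phi> (Complex x y))) powr enn2real p) \<partial>lborel)
           \<le> ennreal (C * N powr enn2real p)"
proof -
  define q where "q = enn2real p"
  have q: "1 \<le> q" using one_le_enn2real[OF p] by (simp add: q_def)
  have hol: "F holomorphic_on upper_half_plane" using F by (simp add: hardy_bound_def)
  have C: "0 < C" using C_ge_1 by simp
  define \<epsilon> where "\<epsilon> = y / (2 * C)"
  have \<epsilon>: "0 < \<epsilon>" using y C by (simp add: \<epsilon>_def)
  define w where "w x = \<phi> (Complex x y) - \<i> * of_real \<epsilon>" for x
  define n where "n t = norm (F (Complex t \<epsilon>)) powr q" for t
  have w: "0 < Im (w x)" for x
  proof -
    have "\<epsilon> < y / C" using y C by (simp add: \<epsilon>_def field_simps)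
    then show ?thesis using Im_lower[of "Complex x y"] y by (simp add: w_def)
  qed
  have contw: "continuous_on UNIV w"
    unfolding w_def using continuous_on_horizontal_line[OF holomorphic y] by (intro continuous_intros)
  have contn: "continuous_on UNIV n"
    unfolding n_def using continuous_on_horizontal_line[OF hol \<epsilon>] q
    by (intro continuous_on_powr' continuous_intros) auto
  have cont2: "continuous_on UNIV (\<lambda>(x, t). poisson_kernel (w x) t * n t)"
    unfolding case_prod_beta
    by (intro continuous_intros continuous_poisson_kernel w
         continuous_on_compose2[OF contw] continuous_on_compose2[OF contn]) auto
  have [measurable]: "(\<lambda>(x, t). ennreal (poisson_kernel (w x) t * n t)) \<in> borel_measurable (lborel \<Otimes>\<^sub>M lborel)"
    using measurable_compose[OF borel_measurable_continuous_onI[OF cont2] measurable_ennreal]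
    by (simp add: lborel_prod case_prod_beta)
  obtain B where B: "\<And>z. \<epsilon> \<le> Im z \<Longrightarrow> norm (F z) \<le> B"
    using hardy_bounded_above_height[OF F p(1) \<epsilon>] by metis
  have "ennreal (norm (F (\<phi> (Complex x y))) powr q)
      \<le> (\<integral>\<^sup>+t. ennreal (poisson_kernel (w x) t * n t) \<partial>lborel)" for x
  proof -
    define f where "f z = F (z + \<i> * of_real \<epsilon>)" for z
    have "(F \<circ> (\<lambda>z. z + \<i> * of_real \<epsilon>)) holomorphic_on {z. - \<epsilon> < Im z}"
      by (rule holomorphic_on_compose_gen[OF _ hol])
         (auto intro!: holomorphic_intros simp: upper_half_plane_def)
    then have "f holomorphic_on {z. - \<epsilon> < Im z}" by (simp add: f_def[abs_def] o_def)
    from norm_powr_le_poisson_integral[OF this \<epsilon> _ w q, of B x]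
    show ?thesis using B by (simp add: f_def n_def w_def Complex_eq)
  qed
  then have "(\<integral>\<^sup>+x. ennreal (norm (F (\<phi> (Complex x y))) powr q) \<partial>lborel)
      \<le> (\<integral>\<^sup>+x. (\<integral>\<^sup>+t. ennreal (poisson_kernel (w x) t * n t) \<partial>lborel) \<partial>lborel)"
    by (intro nn_integral_mono)
  also have "\<dots> = (\<integral>\<^sup>+t. (\<integral>\<^sup>+x. ennreal (poisson_kernel (w x) t * n t) \<partial>lborel) \<partial>lborel)"
    by (rule lborel_pair.Fubini'[symmetric]) measurable
  also have "\<dots> = (\<integral>\<^sup>+t. (\<integral>\<^sup>+x. ennreal (poisson_kernel (w x) t) \<partial>lborel) * ennreal (n t) \<partial>lborel)"
  proof (rule nn_integral_cong)
    fix t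
    have "continuous_on UNIV (\<lambda>x. poisson_kernel (w x) t)"
      by (intro continuous_poisson_kernel contw w continuous_intros)
    then have "(\<lambda>x. ennreal (poisson_kernel (w x) t)) \<in> borel_measurable lborel"
      by (rule borel_measurable_ennreal_continuous)
    then show "(\<integral>\<^sup>+x. ennreal (poisson_kernel (w x) t * n t) \<partial>lborel)
       = (\<integral>\<^sup>+x. ennreal (poisson_kernel (w x) t) \<partial>lborel) * ennreal (n t)"
      using poisson_kernel_nonneg[OF w]
      by (subst nn_integral_multc[symmetric]) (auto simp: ennreal_mult n_def)
  qed
  also have "\<dots> \<le> (\<integral>\<^sup>+t. ennreal C * ennreal (n t) \<partial>lborel)"
    using nn_integral_poisson_kernel_le[OF y]
    by (intro nn_integral_mono mult_right_mono) (auto simp: w_def \<epsilon>_def)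
  also have "\<dots> = ennreal C * (\<integral>\<^sup>+t. ennreal (n t) \<partial>lborel)"
    using borel_measurable_ennreal_continuous[OF contn] by (rule nn_integral_cmult)
  also have "\<dots> \<le> ennreal C * ennreal (N powr q)"
    using F p \<epsilon> by (intro mult_left_mono) (auto simp: hardy_bound_def n_def q_def)
  also have "\<dots> = ennreal (C * N powr q)"
    using C by (simp add: ennreal_mult)
  finally show ?thesis by (simp add: q_def)
qed

lemma hardy_bound_composition:
  assumes F: "hardy_bound p F N" and p: "1 \<le> p"
  shows "hardy_bound p (\<lambda>z. F (\<phi> z)) (C * N)"
proof -
  have hol: "F holomorphic_on upper_half_plane" and N: "0 \<le> N"
    using F by (auto simp: hardy_bound_def)
  have "(F \<circ> \<phi>) holomorphic_on upper_half_plane"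
    using maps_into by (intro holomorphic_on_compose_gen[OF holomorphic hol]) auto
  then have holc: "(\<lambda>z. F (\<phi> z)) holomorphic_on upper_half_plane" by (simp add: o_def)
  have NC: "N \<le> C * N" "0 \<le> C * N" using C_ge_1 N mult_right_mono[of 1 C N] by auto
  show ?thesis
  proof (cases "p = \<infinity>")
    case True
    then show ?thesis using F holc NC maps_into by (force simp: hardy_bound_def)
  next
    case False
    let ?q = "enn2real p"
    have "C * N powr ?q \<le> (C * N) powr ?q"
      using powr_mono[OF one_le_enn2real[OF p False] C_ge_1] C_ge_1 N
      by (simp add: powr_mult mult_right_mono)
    then show ?thesis
      using nn_integral_composition_le[OF F p False] holc NC False
      by (auto simp: hardy_bound_def intro: order_trans ennreal_leI)
  qed
qed

end

section \<open>Sums and products in Hardy-Sobolev spaces\<close>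

lemma hardy_bound_mono: "hardy_bound p F N \<Longrightarrow> N \<le> M \<Longrightarrow> hardy_bound p F M"
  using powr_mono2[of "enn2real p" N M]
  by (auto simp: hardy_bound_def split: if_splits intro: order_trans[OF _ ennreal_leI] order_trans[of _ N M])

lemma hardy_bound_cong:
  assumes eq: "\<And>z. z \<in> upper_half_plane \<Longrightarrow> F z = G z" and F: "hardy_bound p F N"
  shows "hardy_bound p G N"
proof -
  have "G holomorphic_on upper_half_plane"
    using F eq holomorphic_cong[of upper_half_plane upper_half_plane F G] by (auto simp: hardy_bound_def)
  moreover have "F (Complex x y) = G (Complex x y)" if "0 < y" for x y
    using that eq by (simp add: upper_half_plane_def)
  ultimately show ?thesis using F eq by (auto simp: hardy_bound_def)
qed

lemma borel_measurable_horizontal_line: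
  assumes "F holomorphic_on upper_half_plane" "0 < y"
  shows "(\<lambda>x. ennreal (norm (F (Complex x y)) powr q)) \<in> borel_measurable lborel"
proof -
  have [measurable]: "(\<lambda>x. F (Complex x y)) \<in> borel_measurable borel"
    using continuous_on_horizontal_line[OF assms] by (rule borel_measurable_continuous_onI)
  show ?thesis by measurable
qed

text \<open>
  The crude constant comes from \<open>\<bar>a + b\<bar>\<^sup>q \<le> 2\<^sup>q (\<bar>a\<bar>\<^sup>q + \<bar>b\<bar>\<^sup>q)\<close>; being independent of \<open>p\<close>, it lets the
  inductions below treat all exponents at once.
\<close>

lemma hardy_bound_add:
  assumes F: "hardy_bound p F N" and G: "hardy_bound p G M" and p: "1 \<le> p"
  shows "hardy_bound p (\<lambda>z. F z + G z) (4 * (N + M))"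
proof -
  have hol: "F holomorphic_on upper_half_plane" "G holomorphic_on upper_half_plane"
    and N: "0 \<le> N" "0 \<le> M" using F G by (auto simp: hardy_bound_def)
  show ?thesis
  proof (cases "p = \<infinity>")
    case True
    have "norm (F z + G z) \<le> 4 * (N + M)" if "z \<in> upper_half_plane" for z
    proof -
      have "norm (F z) \<le> N" "norm (G z) \<le> M" using F G True that by (auto simp: hardy_bound_def)
      from norm_triangle_mono[OF this] have "norm (F z + G z) \<le> N + M" .
      also have "\<dots> \<le> 4 * (N + M)" using N by simp
      finally show ?thesis .
    qed
    then show ?thesis using True hol N by (auto simp: hardy_bound_def intro!: holomorphic_intros)
  next
    case False
    define q where "q = enn2real p"
    have q: "1 \<le> q" using one_le_enn2real[OF p False] by (simp add: q_def)
    have pt: "norm (u + v) powr q \<le> 2 powr q * (norm u powr q + norm v powr q)" for u v :: complex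
    proof -
      have "norm (u + v) powr q \<le> (2 * max (norm u) (norm v)) powr q"
        using q norm_triangle_ineq[of u v] by (intro powr_mono2) auto
      also have "\<dots> = 2 powr q * max (norm u) (norm v) powr q" by (simp add: powr_mult)
      also have "\<dots> \<le> 2 powr q * (norm u powr q + norm v powr q)"
        by (intro mult_left_mono) (auto simp: max_def)
      finally show ?thesis .
    qed
    have "(\<integral>\<^sup>+x. ennreal (norm (F (Complex x y) + G (Complex x y)) powr q) \<partial>lborel)
        \<le> ennreal ((4 * (N + M)) powr q)" if y: "0 < y" for y
    proof -
      note meas = borel_measurable_horizontal_line[OF hol(1) y, of q]
        borel_measurable_horizontal_line[OF hol(2) y, of q]
      have "(\<integral>\<^sup>+x. ennreal (norm (F (Complex x y) + G (Complex x y)) powr q) \<partial>lborel)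
         \<le> (\<integral>\<^sup>+x. ennreal (2 powr q) * (ennreal (norm (F (Complex x y)) powr q)
               + ennreal (norm (G (Complex x y)) powr q)) \<partial>lborel)"
      proof (rule nn_integral_mono)
        fix x
        show "ennreal (norm (F (Complex x y) + G (Complex x y)) powr q)
           \<le> ennreal (2 powr q) * (ennreal (norm (F (Complex x y)) powr q)
               + ennreal (norm (G (Complex x y)) powr q))"
          using ennreal_leI[OF pt[of "F (Complex x y)" "G (Complex x y)"]]
          by (simp add: ennreal_mult)
      qed
      also have "\<dots> = ennreal (2 powr q) * ((\<integral>\<^sup>+x. ennreal (norm (F (Complex x y)) powr q) \<partial>lborel)
               + (\<integral>\<^sup>+x. ennreal (norm (G (Complex x y)) powr q) \<partial>lborel))"
        using meas by (simp add: nn_integral_cmult nn_integral_add)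
      also have "\<dots> \<le> ennreal (2 powr q) * (ennreal (N powr q) + ennreal (M powr q))"
        using F G False y by (intro mult_left_mono add_mono) (auto simp: hardy_bound_def q_def)
      also have "\<dots> = ennreal (2 powr q * (N powr q + M powr q))"
        by (simp add: ennreal_mult)
      also have "\<dots> \<le> ennreal ((4 * (N + M)) powr q)"
      proof (rule ennreal_leI)
        have "N powr q + M powr q \<le> (N + M) powr q + (N + M) powr q"
          using N q by (intro add_mono powr_mono2) auto
        also have "\<dots> = 2 powr 1 * (N + M) powr q" by simp
        also have "\<dots> \<le> 2 powr q * (N + M) powr q" using q by (intro mult_right_mono powr_mono) auto
        finally have "2 powr q * (N powr q + M powr q) \<le> 2 powr q * (2 powr q * (N + M) powr q)"
          by (intro mult_left_mono) auto
        also have "\<dots> = (2 * 2) powr q * (N + M) powr q" by (simp only: powr_mult mult.assoc)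
        also have "\<dots> = (2 * 2 * (N + M)) powr q" by (simp only: powr_mult)
        finally show "2 powr q * (N powr q + M powr q) \<le> (4 * (N + M)) powr q" by simp
      qed
      finally show ?thesis .
    qed
    then show ?thesis using False hol N
      by (auto simp: hardy_bound_def q_def intro!: holomorphic_intros)
  qed
qed

lemma hardy_bound_mult:
  assumes G: "hardy_bound \<infinity> G B" and F: "hardy_bound p F N"
  shows "hardy_bound p (\<lambda>z. G z * F z) (B * N)"
proof -
  have hol: "F holomorphic_on upper_half_plane" "G holomorphic_on upper_half_plane"
    and N: "0 \<le> N" "0 \<le> B" and B: "\<And>z. z \<in> upper_half_plane \<Longrightarrow> norm (G z) \<le> B"
    using F G by (auto simp: hardy_bound_def)
  show ?thesis
  proof (cases "p = \<infinity>")
    case True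
    then show ?thesis using hol N B F
      by (auto simp: hardy_bound_def norm_mult intro!: holomorphic_intros mult_mono)
  next
    case False
    define q where "q = enn2real p"
    have q: "0 \<le> q" by (simp add: q_def)
    have "(\<integral>\<^sup>+x. ennreal (norm (G (Complex x y) * F (Complex x y)) powr q) \<partial>lborel)
        \<le> ennreal ((B * N) powr q)" if y: "0 < y" for y
    proof -
      have "(\<integral>\<^sup>+x. ennreal (norm (G (Complex x y) * F (Complex x y)) powr q) \<partial>lborel)
         \<le> (\<integral>\<^sup>+x. ennreal (B powr q) * ennreal (norm (F (Complex x y)) powr q) \<partial>lborel)"
      proof (rule nn_integral_mono)
        fix x
        have "norm (G (Complex x y)) powr q \<le> B powr q"
          using B y q by (intro powr_mono2) (auto simp: upper_half_plane_def)
        then show "ennreal (norm (G (Complex x y) * F (Complex x y)) powr q)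
           \<le> ennreal (B powr q) * ennreal (norm (F (Complex x y)) powr q)"
          by (simp add: norm_mult powr_mult ennreal_mult[symmetric] mult_right_mono ennreal_leI)
      qed
      also have "\<dots> = ennreal (B powr q) * (\<integral>\<^sup>+x. ennreal (norm (F (Complex x y)) powr q) \<partial>lborel)"
        using borel_measurable_horizontal_line[OF hol(1) y] by (rule nn_integral_cmult)
      also have "\<dots> \<le> ennreal (B powr q) * ennreal (N powr q)"
        using F False y by (intro mult_left_mono) (auto simp: hardy_bound_def q_def)
      also have "\<dots> = ennreal ((B * N) powr q)" using N by (simp add: ennreal_mult powr_mult)
      finally show ?thesis .
    qed
    then show ?thesis using False hol N
      by (auto simp: hardy_bound_def q_def intro!: holomorphic_intros)
  qed
qed

text \<open>
  A bound on the maximum of the norms of the derivatives instead of their \<open>p\<close>-sum. The two agree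
  up to a factor \<open>m + 1\<close>, and a common bound for all derivatives is what inductions on \<open>m\<close> preserve.
\<close>

definition hardy_sobolev_bound :: "nat \<Rightarrow> ennreal \<Rightarrow> (complex \<Rightarrow> complex) \<Rightarrow> real \<Rightarrow> bool" where
  "hardy_sobolev_bound m p F N \<longleftrightarrow> (\<forall>k\<le>m. hardy_bound p ((deriv ^^ k) F) N)"

lemma hardy_sobolev_bound_0 [simp]: "hardy_sobolev_bound 0 p F N \<longleftrightarrow> hardy_bound p F N"
  by (simp add: hardy_sobolev_bound_def)

lemma hardy_sobolev_bound_Suc:
  "hardy_sobolev_bound (Suc m) p F N \<longleftrightarrow> hardy_bound p F N \<and> hardy_sobolev_bound m p (deriv F) N"
proof -
  have "(\<forall>k\<le>Suc m. P k) \<longleftrightarrow> P 0 \<and> (\<forall>k\<le>m. P (Suc k))" for P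
    by (metis Suc_le_mono le0 not0_implies_Suc)
  note split = this[of "\<lambda>k. hardy_bound p ((deriv ^^ k) F) N"]
  have "(deriv ^^ Suc k) F = (deriv ^^ k) (deriv F)" for k by (simp add: funpow_swap1)
  then show ?thesis unfolding hardy_sobolev_bound_def split by simp
qed

lemma hardy_sobolev_bound_imp_hardy_bound: "hardy_sobolev_bound m p F N \<Longrightarrow> hardy_bound p F N"
  by (auto simp: hardy_sobolev_bound_def dest: spec[of _ 0])

lemma hardy_sobolev_bound_mono:
  "hardy_sobolev_bound m p F N \<Longrightarrow> k \<le> m \<Longrightarrow> N \<le> M \<Longrightarrow> hardy_sobolev_bound k p F M"
  unfolding hardy_sobolev_bound_def by (meson hardy_bound_mono order_trans)

lemma hardy_sobolev_bound_cong:
  assumes "\<And>z. z \<in> upper_half_plane \<Longrightarrow> F z = G z" "hardy_sobolev_bound m p F N"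
  shows "hardy_sobolev_bound m p G N"
proof -
  have "(deriv ^^ k) F z = (deriv ^^ k) G z" if z: "z \<in> upper_half_plane" for k z
    using assms(1) z eventually_nhds_in_open[OF open_upper_half_plane z]
    by (intro higher_deriv_cong_ev) (auto elim: eventually_mono)
  then show ?thesis
    using assms(2) hardy_bound_cong unfolding hardy_sobolev_bound_def by metis
qed

lemma hardy_sobolev_bound_add:
  assumes "1 \<le> p"
  shows "hardy_sobolev_bound m p F N \<Longrightarrow> hardy_sobolev_bound m p G M
    \<Longrightarrow> hardy_sobolev_bound m p (\<lambda>z. F z + G z) (4 * (N + M))"
proof (induction m arbitrary: F G)
  case 0
  then show ?case using hardy_bound_add assms by simp
next
  case (Suc m)
  have hol: "F holomorphic_on upper_half_plane" "G holomorphic_on upper_half_plane"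
    using Suc.prems by (auto simp: hardy_sobolev_bound_Suc hardy_bound_def)
  have "deriv F z + deriv G z = deriv (\<lambda>z. F z + G z) z" if z: "z \<in> upper_half_plane" for z
    using hol[THEN holomorphic_on_imp_differentiable_at[OF _ open_upper_half_plane z]] by simp
  from hardy_sobolev_bound_cong[OF this Suc.IH]
  show ?case using Suc.prems hardy_bound_add[OF _ _ assms] by (auto simp: hardy_sobolev_bound_Suc)
qed

text \<open>
  Induction on \<open>m\<close> through \<open>(G F)' = G F' + G' F\<close>. The two products and the constant \<open>4\<close> for sums
  contribute a factor \<open>8\<close> per derivative.
\<close>

lemma hardy_sobolev_bound_mult:
  assumes p: "1 \<le> p"
  shows "hardy_sobolev_bound m \<infinity> G B \<Longrightarrow> hardy_sobolev_bound m p F N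
    \<Longrightarrow> hardy_sobolev_bound m p (\<lambda>z. G z * F z) (8 ^ m * B * N)"
proof (induction m arbitrary: F G)
  case 0
  then show ?case using hardy_bound_mult by simp
next
  case (Suc m)
  have G: "hardy_bound \<infinity> G B" "hardy_sobolev_bound m \<infinity> G B" "hardy_sobolev_bound m \<infinity> (deriv G) B"
    and F: "hardy_bound p F N" "hardy_sobolev_bound m p F N" "hardy_sobolev_bound m p (deriv F) N"
    using Suc.prems hardy_sobolev_bound_mono[of "Suc m"] by (auto simp: hardy_sobolev_bound_Suc)
  have hol: "G holomorphic_on upper_half_plane" "F holomorphic_on upper_half_plane"
    and BN: "0 \<le> B" "0 \<le> N" using F G by (auto simp: hardy_bound_def)
  have eq: "G z * deriv F z + deriv G z * F z = deriv (\<lambda>z. G z * F z) z" if z: "z \<in> upper_half_plane" for z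
    using hol[THEN holomorphic_on_imp_differentiable_at[OF _ open_upper_half_plane z]] by simp
  have "hardy_sobolev_bound m p (\<lambda>z. G z * deriv F z + deriv G z * F z) (8 ^ Suc m * B * N)"
    using hardy_sobolev_bound_add[OF p Suc.IH[OF G(2) F(3)] Suc.IH[OF G(3) F(2)]]
    by (simp add: ac_simps)
  then have "hardy_sobolev_bound m p (deriv (\<lambda>z. G z * F z)) (8 ^ Suc m * B * N)"
    by (rule hardy_sobolev_bound_cong[rotated]) (rule eq)
  moreover have "B * N \<le> 8 ^ Suc m * B * N"
    using BN mult_right_mono[of 1 "8 ^ Suc m" "B * N"] one_le_power[of "8::real" "Suc m"] by (simp add: mult.assoc)
  then have "hardy_bound p (\<lambda>z. G z * F z) (8 ^ Suc m * B * N)"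
    using hardy_bound_mono[OF hardy_bound_mult[OF G(1) F(1)]] by blast
  ultimately show ?case by (simp add: hardy_sobolev_bound_Suc)
qed

lemma hardy_sobolev_bound_embedding:
  assumes F: "hardy_sobolev_bound (Suc m) p F N" and p: "1 \<le> p"
  shows "hardy_sobolev_bound m \<infinity> F (2 * N)"
  unfolding hardy_sobolev_bound_def
proof (intro allI impI)
  fix k assume "k \<le> m"
  then have "hardy_bound p ((deriv ^^ k) F) N" "hardy_bound p ((deriv ^^ Suc k) F) N"
    using F unfolding hardy_sobolev_bound_def by auto
  then show "hardy_bound \<infinity> ((deriv ^^ k) F) (2 * N)"
    using hardy_sobolev_embedding[OF _ _ p] by simp
qed

text \<open>
  \<open>H\<^sub>n\<^sup>p\<close> is an algebra for \<open>n = m + 1\<close>: in \<open>(G F)' = G F' + F G'\<close> the undifferentiated factor lies in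
  \<open>H\<^sub>m\<^sup>\<infinity>\<close> by the embedding and the derivative in \<open>H\<^sub>m\<^sup>p\<close>, so both terms fall under the multiplier bound.
\<close>

lemma hardy_sobolev_bound_product:
  assumes p: "1 \<le> p"
    and G: "hardy_sobolev_bound (Suc m) p G M" and F: "hardy_sobolev_bound (Suc m) p F N"
  shows "hardy_sobolev_bound (Suc m) p (\<lambda>z. G z * F z) (16 * 8 ^ m * M * N)"
proof -
  have G': "hardy_bound p G M" "hardy_sobolev_bound m p (deriv G) M" "hardy_sobolev_bound m \<infinity> G (2 * M)"
    and F': "hardy_bound p F N" "hardy_sobolev_bound m p (deriv F) N" "hardy_sobolev_bound m \<infinity> F (2 * N)"
    using G F hardy_sobolev_bound_embedding[OF _ p] by (auto simp: hardy_sobolev_bound_Suc)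
  have hol: "G holomorphic_on upper_half_plane" "F holomorphic_on upper_half_plane"
    and MN: "0 \<le> M" "0 \<le> N" using F' G' by (auto simp: hardy_bound_def)
  have eq: "G z * deriv F z + F z * deriv G z = deriv (\<lambda>z. G z * F z) z" if z: "z \<in> upper_half_plane" for z
    using hol[THEN holomorphic_on_imp_differentiable_at[OF _ open_upper_half_plane z]]
    by (simp add: mult.commute)
  have "hardy_sobolev_bound m p (\<lambda>z. G z * deriv F z + F z * deriv G z) (16 * 8 ^ m * M * N)"
    using hardy_sobolev_bound_add[OF p hardy_sobolev_bound_mult[OF p G'(3) F'(2)]
       hardy_sobolev_bound_mult[OF p F'(3) G'(2)]] by (simp add: ac_simps)
  then have "hardy_sobolev_bound m p (deriv (\<lambda>z. G z * F z)) (16 * 8 ^ m * M * N)"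
    by (rule hardy_sobolev_bound_cong[rotated]) (rule eq)
  moreover have "(1::real) \<le> 8 ^ m" by simp
  then have "(2::real) \<le> 16 * 8 ^ m" by linarith
  then have "2 * M * N \<le> 16 * 8 ^ m * M * N" using MN by (intro mult_right_mono)
  then have "hardy_bound p (\<lambda>z. G z * F z) (16 * 8 ^ m * M * N)"
    using hardy_bound_mono[OF hardy_bound_mult[OF hardy_sobolev_bound_imp_hardy_bound[OF G'(3)] F'(1)]] by blast
  ultimately show ?thesis by (simp add: hardy_sobolev_bound_Suc)
qed

text \<open>
  Induction on \<open>m\<close> through \<open>(F \<circ> \<phi>)' = \<phi>' \<cdot> (F' \<circ> \<phi>)\<close>: the second factor is controlled in \<open>H\<^sub>m\<^sup>p\<close> by the
  induction hypothesis and the first is a multiplier.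
\<close>

lemma (in angular_self_map) hardy_sobolev_bound_composition:
  assumes p: "1 \<le> p"
  shows "m = 0 \<or> hardy_sobolev_bound (m - 1) \<infinity> (deriv \<phi>) B \<Longrightarrow>
    \<exists>K. \<forall>F N. hardy_sobolev_bound m p F N \<longrightarrow> hardy_sobolev_bound m p (\<lambda>z. F (\<phi> z)) (K * N)"
proof (induction m)
  case 0
  then show ?case using hardy_bound_composition[OF _ p] by auto
next
  case (Suc m)
  then have \<phi>': "hardy_sobolev_bound m \<infinity> (deriv \<phi>) B" by simp
  then have "m = 0 \<or> hardy_sobolev_bound (m - 1) \<infinity> (deriv \<phi>) B"
    using hardy_sobolev_bound_mono by (metis diff_le_self order_refl)
  from Suc.IH[OF this] obtain K where
    K: "\<And>F N. hardy_sobolev_bound m p F N \<Longrightarrow> hardy_sobolev_bound m p (\<lambda>z. F (\<phi> z)) (K * N)" by blast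
  have "hardy_sobolev_bound (Suc m) p (\<lambda>z. F (\<phi> z)) (max C (8 ^ m * B * K) * N)"
    if F: "hardy_sobolev_bound (Suc m) p F N" for F N
  proof -
    have F': "hardy_bound p F N" "hardy_sobolev_bound m p (deriv F) N"
      using F by (auto simp: hardy_sobolev_bound_Suc)
    then have hol: "F holomorphic_on upper_half_plane" and N: "0 \<le> N" by (auto simp: hardy_bound_def)
    have eq: "deriv \<phi> z * deriv F (\<phi> z) = deriv (\<lambda>z. F (\<phi> z)) z" if z: "z \<in> upper_half_plane" for z
      using deriv_chain[of \<phi> z F] maps_into[OF z] z
        holomorphic_on_imp_differentiable_at[OF holomorphic open_upper_half_plane]
        holomorphic_on_imp_differentiable_at[OF hol open_upper_half_plane]
      by (simp add: o_def mult.commute)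
    have "hardy_sobolev_bound m p (\<lambda>z. deriv \<phi> z * deriv F (\<phi> z)) (8 ^ m * B * (K * N))"
      by (rule hardy_sobolev_bound_mult[OF p \<phi>' K[OF F'(2)]])
    then have "hardy_sobolev_bound m p (deriv (\<lambda>z. F (\<phi> z))) (8 ^ m * B * (K * N))"
      by (rule hardy_sobolev_bound_cong[rotated]) (rule eq)
    moreover have "8 ^ m * B * (K * N) \<le> max C (8 ^ m * B * K) * N"
      using N by (simp add: mult.assoc[symmetric] mult_right_mono)
    ultimately have "hardy_sobolev_bound m p (deriv (\<lambda>z. F (\<phi> z))) (max C (8 ^ m * B * K) * N)"
      by (blast intro: hardy_sobolev_bound_mono)
    moreover have "hardy_bound p (\<lambda>z. F (\<phi> z)) (max C (8 ^ m * B * K) * N)"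
      using N by (intro hardy_bound_mono[OF hardy_bound_composition[OF F'(1) p]] mult_right_mono) auto
    ultimately show ?thesis by (simp add: hardy_sobolev_bound_Suc)
  qed
  then show ?case by blast
qed

section \<open>From bounds to norms\<close>

lemma line_norm_le_iff:
  assumes "0 < q" "0 \<le> N"
  shows "line_norm q F y \<le> N \<longleftrightarrow> (LINT x|lborel. norm (F (Complex x y)) powr q) \<le> N powr q"
proof -
  let ?I = "LINT x|lborel. norm (F (Complex x y)) powr q"
  have I: "0 \<le> ?I" by simp
  have "?I powr (1/q) \<le> N \<longleftrightarrow> (?I powr (1/q)) powr q \<le> N powr q"
    using assms by (meson powr_ge_zero powr_le_cancel_iff powr_mono2 less_imp_le powr_less_mono2 not_le)
  then show ?thesis using assms I by (simp add: line_norm_def powr_powr)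
qed

lemma hardy_bound_hardy_norm:
  assumes F: "F \<in> hardy_space p" and p: "1 \<le> p"
  shows "hardy_bound p F (hardy_norm p F)"
proof (cases "p = \<infinity>")
  case True
  have le: "norm (F z) \<le> hardy_norm p F" if "z \<in> upper_half_plane" for z
    using F True that by (auto simp: hardy_space_def hardy_norm_def intro!: cSUP_upper)
  have "0 \<le> norm (F \<i>)" by simp
  also have "\<dots> \<le> hardy_norm p F" by (rule le) (simp add: upper_half_plane_def)
  finally show ?thesis using True F le by (simp add: hardy_bound_def hardy_space_def)
next
  case False
  let ?q = "enn2real p"
  have q: "1 \<le> ?q" using one_le_enn2real[OF p False] .
  have le: "line_norm ?q F y \<le> hardy_norm p F" if "0 < y" for y
    using F False that by (auto simp: hardy_space_def hardy_norm_def intro!: cSUP_upper)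
  have "0 \<le> line_norm ?q F 1" by (simp add: line_norm_def)
  also have "\<dots> \<le> hardy_norm p F" by (rule le) simp
  finally have nn: "0 \<le> hardy_norm p F" .
  have "(\<integral>\<^sup>+x. ennreal (norm (F (Complex x y)) powr ?q) \<partial>lborel) \<le> ennreal (hardy_norm p F powr ?q)"
    if y: "0 < y" for y
  proof -
    have "integrable lborel (\<lambda>x. norm (F (Complex x y)) powr ?q)"
      using F False y by (simp add: hardy_space_def)
    from nn_integral_eq_integral[OF this] show ?thesis
      using le[OF y] line_norm_le_iff[of ?q "hardy_norm p F" F y] q nn by (simp add: ennreal_leI)
  qed
  then show ?thesis using False F nn by (simp add: hardy_bound_def hardy_space_def)
qed

lemma
  assumes F: "hardy_bound p F N" and p: "1 \<le> p"
  shows hardy_bound_imp_hardy_space: "F \<in> hardy_space p"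
    and hardy_bound_imp_hardy_norm_le: "hardy_norm p F \<le> N"
proof -
  have hol: "F holomorphic_on upper_half_plane" and N: "0 \<le> N" using F by (auto simp: hardy_bound_def)
  have "F \<in> hardy_space p \<and> hardy_norm p F \<le> N"
  proof (cases "p = \<infinity>")
    case True
    have "upper_half_plane \<noteq> {}" by (auto simp: upper_half_plane_def intro!: exI[of _ \<i>])
    then show ?thesis using True F
      by (auto simp: hardy_space_def hardy_norm_def hardy_bound_def bdd_above_def intro!: cSUP_least)
  next
    case False
    let ?q = "enn2real p"
    have q: "1 \<le> ?q" using one_le_enn2real[OF p False] .
    have nn: "(\<integral>\<^sup>+x. ennreal (norm (F (Complex x y)) powr ?q) \<partial>lborel) \<le> ennreal (N powr ?q)"
      if "0 < y" for y using F False that by (simp add: hardy_bound_def)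
    have int: "integrable lborel (\<lambda>x. norm (F (Complex x y)) powr ?q)" if y: "0 < y" for y
    proof (rule integrableI_nonneg)
      show "(\<lambda>x. norm (F (Complex x y)) powr ?q) \<in> borel_measurable lborel"
        using continuous_on_horizontal_line[OF hol y] q
        by (simp, intro borel_measurable_continuous_onI continuous_on_powr' continuous_intros) auto
      show "(\<integral>\<^sup>+x. ennreal (norm (F (Complex x y)) powr ?q) \<partial>lborel) < \<infinity>"
        using le_less_trans[OF nn[OF y]] by simp
    qed simp
    have "line_norm ?q F y \<le> N" if y: "0 < y" for y
      using nn_integral_eq_integral[OF int[OF y]] nn[OF y] line_norm_le_iff[of ?q N F y] q N by simp
    then show ?thesis using False int hol
      by (auto simp: hardy_space_def hardy_norm_def bdd_above_def intro!: cSUP_least)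
  qed
  then show "F \<in> hardy_space p" "hardy_norm p F \<le> N" by auto
qed

lemma hardy_sobolev_bound_hardy_sobolev_norm:
  assumes F: "F \<in> hardy_sobolev_space m p" and p: "1 \<le> p"
  shows "hardy_sobolev_bound m p F (hardy_sobolev_norm m p F)"
  unfolding hardy_sobolev_bound_def
proof (intro allI impI)
  fix k assume k: "k \<le> m"
  let ?h = "\<lambda>k. hardy_norm p ((deriv ^^ k) F)"
  have hb: "hardy_bound p ((deriv ^^ j) F) (?h j)" if "j \<le> m" for j
    using F that hardy_bound_hardy_norm[OF _ p] by (auto simp: hardy_sobolev_space_def)
  then have nn: "0 \<le> ?h j" if "j \<le> m" for j using that by (auto simp: hardy_bound_def)
  have "?h k \<le> hardy_sobolev_norm m p F"
  proof (cases "p = \<infinity>")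
    case True
    then show ?thesis
      using member_le_sum[of k "{..m}" ?h] k nn by (simp add: hardy_sobolev_norm_def)
  next
    case False
    let ?q = "enn2real p"
    have q: "1 \<le> ?q" using one_le_enn2real[OF p False] .
    have "?h k = (?h k powr ?q) powr (1 / ?q)" using q nn[OF k] by (simp add: powr_powr)
    also have "\<dots> \<le> (\<Sum>k\<le>m. ?h k powr ?q) powr (1 / ?q)"
      using member_le_sum[of k "{..m}" "\<lambda>k. ?h k powr ?q"] k q by (intro powr_mono2) auto
    finally show ?thesis using False by (simp add: hardy_sobolev_norm_def)
  qed
  then show "hardy_bound p ((deriv ^^ k) F) (hardy_sobolev_norm m p F)"
    using hardy_bound_mono[OF hb[OF k]] by blast
qed

lemma
  assumes F: "hardy_sobolev_bound m p F N" and p: "1 \<le> p"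
  shows hardy_sobolev_bound_imp_space: "F \<in> hardy_sobolev_space m p"
    and hardy_sobolev_bound_imp_norm_le: "hardy_sobolev_norm m p F \<le> real (Suc m) * N"
proof -
  let ?h = "\<lambda>k. hardy_norm p ((deriv ^^ k) F)"
  have hb: "hardy_bound p ((deriv ^^ k) F) N" if "k \<le> m" for k
    using F that by (simp add: hardy_sobolev_bound_def)
  have N: "0 \<le> N" and hol: "F holomorphic_on upper_half_plane" using hb[of 0] by (auto simp: hardy_bound_def)
  show "F \<in> hardy_sobolev_space m p"
    using hol hb hardy_bound_imp_hardy_space[OF _ p] by (auto simp: hardy_sobolev_space_def)
  have le: "?h k \<le> N" if "k \<le> m" for k using hardy_bound_imp_hardy_norm_le[OF hb[OF that] p] .
  have nn: "0 \<le> ?h k" if "k \<le> m" for k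
    using hardy_bound_hardy_norm[OF hardy_bound_imp_hardy_space[OF hb[OF that] p] p]
    by (simp add: hardy_bound_def)
  show "hardy_sobolev_norm m p F \<le> real (Suc m) * N"
  proof (cases "p = \<infinity>")
    case True
    then show ?thesis using sum_bounded_above[of "{..m}" ?h N] le by (simp add: hardy_sobolev_norm_def)
  next
    case False
    let ?q = "enn2real p"
    have q: "1 \<le> ?q" using one_le_enn2real[OF p False] .
    have "?h k powr ?q \<le> N powr ?q" if "k \<in> {..m}" for k
      using le[of k] nn[of k] q that by (intro powr_mono2) auto
    from sum_bounded_above[of "{..m}" "\<lambda>k. ?h k powr ?q" "N powr ?q", OF this]
    have "(\<Sum>k\<le>m. ?h k powr ?q) powr (1 / ?q) \<le> (real (Suc m) * N powr ?q) powr (1 / ?q)"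
      using q by (intro powr_mono2 sum_nonneg) auto
    also have "\<dots> = real (Suc m) powr (1 / ?q) * N"
      using q N by (simp add: powr_mult powr_powr)
    also have "\<dots> \<le> real (Suc m) powr 1 * N"
      using q N by (intro mult_right_mono powr_mono) auto
    finally show ?thesis using False by (simp add: hardy_sobolev_norm_def)
  qed
qed

section \<open>Weighted composition operators\<close>

theorem theorem5p8:
  fixes n :: nat and p :: ennreal and \<psi> \<phi> :: "complex \<Rightarrow> complex"
  assumes "1 \<le> n" and "1 \<le> p"
    and "\<psi> \<in> hardy_sobolev_space n \<infinity> \<or> \<psi> \<in> hardy_sobolev_space n p"
    and "holomorphic_self_map \<phi>"
    and "deriv \<phi> \<in> hardy_sobolev_space (n - 1) \<infinity>"
    and "finite_angular_derivative_at_infinity \<phi>"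
  shows "bounded_on_hardy_sobolev n p (weighted_composition \<psi> \<phi>)"
proof -
  obtain C0 where C0: "\<And>z. z \<in> upper_half_plane \<Longrightarrow> Im z / Im (\<phi> z) \<le> C0"
    using assms(6) by (auto simp: finite_angular_derivative_at_infinity_def bdd_above_def)
  interpret angular_self_map \<phi> "max 1 C0"
  proof
    fix z assume z: "z \<in> upper_half_plane"
    then have "0 < Im (\<phi> z)" using assms(4) by (auto simp: holomorphic_self_map_def upper_half_plane_def)
    moreover have "Im z / Im (\<phi> z) \<le> max 1 C0" using C0[OF z] by simp
    ultimately show "Im z \<le> max 1 C0 * Im (\<phi> z)" by (simp add: divide_le_eq)
  qed (use assms(4) in \<open>auto simp: holomorphic_self_map_def\<close>)
  obtain K where K: "\<And>F N. hardy_sobolev_bound n p F N \<Longrightarrow> hardy_sobolev_bound n p (\<lambda>z. F (\<phi> z)) (K * N)"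
    using hardy_sobolev_bound_composition[OF assms(2)
      disjI2[OF hardy_sobolev_bound_hardy_sobolev_norm[OF assms(5)]]] by auto
  obtain L where L: "\<And>G N. hardy_sobolev_bound n p G N \<Longrightarrow> hardy_sobolev_bound n p (\<lambda>z. \<psi> z * G z) (L * N)"
    using assms(3)
  proof
    assume "\<psi> \<in> hardy_sobolev_space n \<infinity>"
    from hardy_sobolev_bound_mult[OF assms(2) hardy_sobolev_bound_hardy_sobolev_norm[OF this]]
    show ?thesis using that by auto
  next
    assume \<psi>: "\<psi> \<in> hardy_sobolev_space n p"
    obtain m where n: "n = Suc m" using assms(1) by (cases n) auto
    from hardy_sobolev_bound_product[OF assms(2)
      hardy_sobolev_bound_hardy_sobolev_norm[OF \<psi> assms(2), unfolded n]]
    show ?thesis using that unfolding n by blast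
  qed
  have *: "hardy_sobolev_bound n p (weighted_composition \<psi> \<phi> F) (L * (K * hardy_sobolev_norm n p F))"
    if "F \<in> hardy_sobolev_space n p" for F
    unfolding weighted_composition_def
    using L K hardy_sobolev_bound_hardy_sobolev_norm[OF that assms(2)] by blast
  show ?thesis unfolding bounded_on_hardy_sobolev_def
  proof (intro conjI exI[of _ "real (Suc n) * (L * K)"] ballI)
    fix F assume F: "F \<in> hardy_sobolev_space n p"
    show "weighted_composition \<psi> \<phi> F \<in> hardy_sobolev_space n p"
      using hardy_sobolev_bound_imp_space[OF *[OF F] assms(2)] .
    show "hardy_sobolev_norm n p (weighted_composition \<psi> \<phi> F)
        \<le> real (Suc n) * (L * K) * hardy_sobolev_norm n p F"
      using hardy_sobolev_bound_imp_norm_le[OF *[OF F] assms(2)] by (simp add: mult.assoc)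
  qed
qed

end
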